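(* Let $(\epsilon_n)_{n}$ be a sequence of positive numbers with $n\epsilon_n^2\to 0$ and $\frac{n\epsilon_n}{\log n}\to\infty$ as $n\to\infty$. For each $n$ let $G_n$ be the random geometric graph on the unit circle with parameters $n,\epsilon_n$, with nodes $x_0,\dots,x_{n-1}$ labeled counterclockwise, and consider the Kuramoto system on $G_n$, $$\frac{d}{dt}u_i=\frac{\pi}{n^2\epsilon_n^3}\sum_{j\sim i}\sin(u_j-u_i),\qquad i=0,1,\dots,n-1. \tag{K}$$ Then for each $q\in\mathbb{Z}$, $$\lim_{n\to\infty}\mathbb{P}\left(\text{(K) has an asymptotically stable equilibrium with index } q\right)=1.$$
   Context: Random geometric graph: $\mathbb{S}^1=\{z\in\mathbb{C}:|z|=1\}$ with geodesic distance $d(x,y)=\cos^{-1}(x\cdot y)\in[0,\pi]$. The node set $V=\{x_0,\dots,x_{n-1}\}$ is a sample of $n$ i.i.d. uniform random variables on $\mathbb{S}^1$, labeled counterclockwise, with coordinates on the circle rotated so that $\arg(x_0)=0$, and $x_n:=x_0$ (indices are cyclic). For $i\neq j$, $i\sim j$ (that is, $\{x_i,x_j\}$ is an edge) if and only if $d(x_i,x_j)<\epsilon_n$. Index (winding number): for $\theta=(\theta_0,\dots,\theta_{n-1})$ (real numbers, or angles modulo $2\pi$), with $\theta_n:=\theta_0$, such that $e^{\mathrm{i}\theta_j}\neq -e^{\mathrm{i}\theta_{j-1}}$ for all $1\le j\le n$, set $$I(\theta)=\frac{1}{2\pi}\sum_{j=1}^n \theta_j\circleddash\theta_{j-1},$$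 where $\theta_j\circleddash\theta_{j-1}$ is the unique number in $(-\pi,\pi)$ congruent to $\theta_j-\theta_{j-1}$ modulo $2\pi$. Then $I(\theta)\in\mathbb{Z}$. It is the winding number around $0$ of the closed curve in $\mathbb{S}^1$ obtained by concatenating the geodesics from $e^{\mathrm{i}\theta_{j-1}}$ to $e^{\mathrm{i}\theta_j}$, $j=1,\dots,n$. If the non-antipodality condition fails, the index is not defined. An equilibrium $u^*=(u^*_0,\dots,u^*_{n-1})$ has index $q$ if $I(u^* )$ is defined and equals $q$. Convention on stability: the system is invariant under shifts $u\mapsto u+c(1,\dots,1)$, and each hyperplane $\{u:\sum_i u_i=c\}$ is invariant under the flow and carries a copy of the same dynamics. Hence the system is always understood as restricted to the invariant hyperplane $\{u\in\mathbb{R}^n:\sum_i u_i=0\}$ (the orthogonal complement of $(1,\dots,1)$), and "asymptotically stable equilibrium" means asymptotically stable (in the usual Lyapunov sense) for the system restricted to this hyperplane. *)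

theory Defs
  imports "HOL-Probability.Probability"
begin

text \<open>
  Vectors of \<open>\<real>\<^sup>n\<close>, with \<open>n\<close> varying, are functions \<open>nat \<Rightarrow> real\<close> (node positions: \<open>nat \<Rightarrow> complex\<close>)
  of which only the entries with index \<open>i < n\<close> are ever inspected.
\<close>

section \<open>Random geometric graphs on the circle\<close>

definition circle_uniform :: "complex measure" where
  "circle_uniform = distr (uniform_measure lborel {0..<2 * pi}) borel cis"

definition uniform_circle_sample :: "'a measure \<Rightarrow> nat \<Rightarrow> (nat \<Rightarrow> 'a \<Rightarrow> complex) \<Rightarrow> bool" where
  "uniform_circle_sample M n X \<longleftrightarrow>
     prob_space M \<and>
     (\<forall>i<n. \<forall>\<omega>\<in>space M. X i \<omega> \<in> sphere 0 1) \<and>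
     prob_space.indep_vars M (\<lambda>_. borel) X {..<n} \<and>
     (\<forall>i<n. distr M borel (X i) = circle_uniform)"

text \<open>
  The circle is rotated so that the first sample point \<open>s 0\<close> sits at \<open>1\<close>, and the points are listed
  by increasing argument in \<open>[0, 2\<pi>)\<close>; hence node 0 has argument 0.
\<close>

definition ccw_nodes :: "nat \<Rightarrow> (nat \<Rightarrow> complex) \<Rightarrow> nat \<Rightarrow> complex" where
  "ccw_nodes n s i = sort_key Arg2pi (map (\<lambda>k. s k / s 0) [0..<n]) ! i"

definition geodesic_dist :: "complex \<Rightarrow> complex \<Rightarrow> real" where
  "geodesic_dist x y = arccos (x \<bullet> y)"

definition rgg_adj :: "real \<Rightarrow> (nat \<Rightarrow> complex) \<Rightarrow> nat \<Rightarrow> nat \<Rightarrow> bool" where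
  "rgg_adj \<epsilon> x i j \<longleftrightarrow> i \<noteq> j \<and> geodesic_dist (x i) (x j) < \<epsilon>"

section \<open>The Kuramoto system\<close>

definition kuramoto_field ::
  "nat \<Rightarrow> real \<Rightarrow> (nat \<Rightarrow> nat \<Rightarrow> bool) \<Rightarrow> (nat \<Rightarrow> real) \<Rightarrow> nat \<Rightarrow> real" where
  "kuramoto_field n \<epsilon> adj u i =
     pi / ((real n)\<^sup>2 * \<epsilon> ^ 3) * (\<Sum>j | j < n \<and> adj i j. sin (u j - u i))"

section \<open>Asymptotic stability of a system restricted to a phase space\<close>

definition solution_on ::
  "nat \<Rightarrow> ((nat \<Rightarrow> real) \<Rightarrow> nat \<Rightarrow> real) \<Rightarrow> (nat \<Rightarrow> real) set \<Rightarrow> (real \<Rightarrow> nat \<Rightarrow> real) \<Rightarrow> bool" where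
  "solution_on n F S \<phi> \<longleftrightarrow>
     (\<forall>t\<ge>0. \<phi> t \<in> S \<and>
        (\<forall>i<n. ((\<lambda>s. \<phi> s i) has_real_derivative F (\<phi> t) i) (at t within {0..})))"

definition equilibrium_on ::
  "nat \<Rightarrow> ((nat \<Rightarrow> real) \<Rightarrow> nat \<Rightarrow> real) \<Rightarrow> (nat \<Rightarrow> real) set \<Rightarrow> (nat \<Rightarrow> real) \<Rightarrow> bool" where
  "equilibrium_on n F S u \<longleftrightarrow> u \<in> S \<and> (\<forall>i<n. F u i = 0)"

definition vdist :: "nat \<Rightarrow> (nat \<Rightarrow> real) \<Rightarrow> (nat \<Rightarrow> real) \<Rightarrow> real" where
  "vdist n u v = L2_set (\<lambda>i. u i - v i) {..<n}"

text \<open>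
  Quantifying over solutions on all of \<open>[0, \<infinity>)\<close> loses nothing when, as for the Kuramoto field,
  \<open>F\<close> is globally Lipschitz and \<open>S\<close> is invariant: then every point of \<open>S\<close> starts such a solution.
\<close>

definition lyapunov_stable_on ::
  "nat \<Rightarrow> ((nat \<Rightarrow> real) \<Rightarrow> nat \<Rightarrow> real) \<Rightarrow> (nat \<Rightarrow> real) set \<Rightarrow> (nat \<Rightarrow> real) \<Rightarrow> bool" where
  "lyapunov_stable_on n F S u \<longleftrightarrow>
     (\<forall>e>0. \<exists>d>0. \<forall>\<phi>. solution_on n F S \<phi> \<and> vdist n (\<phi> 0) u < d \<longrightarrow>
        (\<forall>t\<ge>0. vdist n (\<phi> t) u < e))"

definition attractive_on ::
  "nat \<Rightarrow> ((nat \<Rightarrow> real) \<Rightarrow> nat \<Rightarrow> real) \<Rightarrow> (nat \<Rightarrow> real) set \<Rightarrow> (nat \<Rightarrow> real) \<Rightarrow> bool" where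
  "attractive_on n F S u \<longleftrightarrow>
     (\<exists>d>0. \<forall>\<phi>. solution_on n F S \<phi> \<and> vdist n (\<phi> 0) u < d \<longrightarrow>
        ((\<lambda>t. vdist n (\<phi> t) u) \<longlongrightarrow> 0) at_top)"

definition asymptotically_stable_on ::
  "nat \<Rightarrow> ((nat \<Rightarrow> real) \<Rightarrow> nat \<Rightarrow> real) \<Rightarrow> (nat \<Rightarrow> real) set \<Rightarrow> (nat \<Rightarrow> real) \<Rightarrow> bool" where
  "asymptotically_stable_on n F S u \<longleftrightarrow>
     equilibrium_on n F S u \<and> lyapunov_stable_on n F S u \<and> attractive_on n F S u"

definition zero_sum_hyperplane :: "nat \<Rightarrow> (nat \<Rightarrow> real) set" where
  "zero_sum_hyperplane n = {u. (\<Sum>i<n. u i) = 0}"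

section \<open>The index (winding number)\<close>

definition angle_diff :: "real \<Rightarrow> real \<Rightarrow> real" where
  "angle_diff a b = (THE r. -pi < r \<and> r < pi \<and> (\<exists>k::int. r = a - b + 2 * pi * of_int k))"

text \<open>The indices are cyclic: \<open>j mod n\<close> realises \<open>\<theta>\<^sub>n = \<theta>\<^sub>0\<close>.\<close>

definition index_defined :: "nat \<Rightarrow> (nat \<Rightarrow> real) \<Rightarrow> bool" where
  "index_defined n \<theta> \<longleftrightarrow> (\<forall>j\<in>{1..n}. cis (\<theta> (j mod n)) \<noteq> - cis (\<theta> (j - 1)))"

definition index :: "nat \<Rightarrow> (nat \<Rightarrow> real) \<Rightarrow> real" where
  "index n \<theta> = 1 / (2 * pi) * (\<Sum>j=1..n. angle_diff (\<theta> (j mod n)) (\<theta> (j - 1)))"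

definition has_index :: "nat \<Rightarrow> (nat \<Rightarrow> real) \<Rightarrow> int \<Rightarrow> bool" where
  "has_index n \<theta> q \<longleftrightarrow> index_defined n \<theta> \<and> index n \<theta> = of_int q"

end

theory Submission
  imports Defs
begin

text \<open>
  The Kuramoto system is the gradient flow of the energy
  \<open>E(u) = \<Sum>\<^bsub>i \<sim> j\<^esub> (1 - cos (u\<^sub>j - u\<^sub>i))\<close>, and the natural candidate for a state of index \<open>q\<close> is
  the twisted configuration \<open>u\<^sub>i = q \<theta>\<^sub>i\<close>, where \<open>\<theta>\<^sub>i\<close> is the argument of node \<open>i\<close>. It is not an
  equilibrium of the random graph, but minimising \<open>E\<close> near it produces one.

  Each difference \<open>u\<^sub>j - u\<^sub>i\<close> along an edge is lifted to a real number \<open>\<delta>\<^sub>i\<^sub>j\<close> by adding the multiple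
  of \<open>2 \<pi>\<close> for which the twisted configuration has \<open>\<delta>\<^sub>i\<^sub>j = q d\<^sub>i\<^sub>j\<close>, with \<open>d\<^sub>i\<^sub>j\<close> the signed angle from
  node \<open>i\<close> to node \<open>j\<close>. Let \<open>u\<close> minimise \<open>E\<close> among the configurations with
  \<open>\<bar>\<delta>\<^sub>i\<^sub>j\<bar> \<le> \<pi> / 3\<close> on all edges; up to a common shift of the phases this set is compact. If no
  constraint is active at \<open>u\<close>, then \<open>u\<close> is an equilibrium (\<open>interior_minimiser_is_equilibrium\<close>).

  Constraints are inactive by a comparison of energies. Since \<open>\<bar>d\<^sub>i\<^sub>j\<bar> < \<epsilon>\<close>, the twisted
  configuration has energy at most \<open>n D (q \<epsilon>)\<^sup>2 / 2\<close>, where \<open>D\<close> bounds the degrees. On the other hand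
  the two ends of an edge lie within \<open>\<epsilon>\<close> of all nodes in the ball of radius \<open>\<epsilon> / 2\<close> around their
  midpoint. If there are at least \<open>m\<close> such nodes \<open>k\<close>, then \<open>\<delta>\<^sub>i\<^sub>j = \<delta>\<^sub>i\<^sub>k + \<delta>\<^sub>k\<^sub>j\<close> shows that the energy is at
  least a constant times \<open>m \<delta>\<^sub>i\<^sub>j\<^sup>2\<close>: one stretched edge forces many others to be stretched. Hence
  \<open>\<delta>\<^sub>i\<^sub>j\<^sup>2\<close> is at most a constant times \<open>(D / m) q\<^sup>2 n \<epsilon>\<^sup>2\<close>, and this tends to \<open>0\<close> because
  \<open>n \<epsilon>\<^sup>2 \<rightarrow> 0\<close>, provided that \<open>D / m\<close> stays bounded.

  Phase differences below \<open>\<pi> / 2\<close> on a connected graph also give asymptotic stability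
  (\<open>acute_equilibrium_asymptotically_stable\<close>): the squared distance to \<open>u\<close> is a strict Lyapunov
  function, because \<open>sin\<close> increases along every edge. The index is \<open>q\<close>, because
  consecutive nodes are adjacent: in the sum of the lifted differences around the circle the phases
  telescope away and leave \<open>q\<close> times one full turn.

  Randomness enters only through the counts of nodes in arcs. The circle is cut into \<open>m\<close> sectors
  of width comparable to \<open>\<epsilon>\<close>. A Chernoff bound and a union bound show that, with probability at least
  \<open>1 - 2 m exp (- n / (4 m))\<close>, all of them contain between \<open>n / (4 m)\<close> and \<open>3 n / m\<close> sample points; the
  assumption \<open>n \<epsilon> / ln n \<rightarrow> \<infinity>\<close> makes the error at most \<open>2 / n\<close>. This event does not refer to the
  rotation and ordering of the nodes, so it is transferred to the ordered nodes by counting. Finally, the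
  event in question is measurable because it depends on the sample only through the finite graph.
\<close>

section \<open>Asymptotic stability of equilibria with acute phase differences\<close>

text \<open>
  The mean value theorem: between \<open>a\<close> and \<open>a + x\<close> the derivative of \<open>sin\<close> is at least \<open>cos (b + r)\<close>.
\<close>
lemma sin_increment_lower_bound:
  fixes a x b r :: real
  assumes "\<bar>a\<bar> \<le> b" "\<bar>x\<bar> \<le> r" "b + r \<le> pi"
  shows "cos (b + r) * x\<^sup>2 \<le> x * (sin (a + x) - sin a)"
proof -
  have pos: "cos (b + r) * y \<le> sin (c + y) - sin c"
    if "\<bar>c\<bar> \<le> b" "0 < y" "y \<le> r" for c y :: real
  proof -
    obtain z where z: "c < z" "z < c + y" "sin (c + y) - sin c = (c + y - c) * cos z"
      using MVT2[of c "c + y" sin cos] \<open>0 < y\<close> DERIV_sin by auto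
    have "cos (b + r) \<le> cos \<bar>z\<bar>"
      by (rule cos_monotone_0_pi_le) (use z that assms in auto)
    then show ?thesis
      using z \<open>0 < y\<close> by (simp add: mult.commute mult_left_mono)
  qed
  consider "x = 0" | "x > 0" | "x < 0" by linarith
  then show ?thesis
  proof cases
    case 2
    then have "cos (b + r) * x \<le> sin (a + x) - sin a" using pos[of a x] assms by auto
    then have "x * (cos (b + r) * x) \<le> x * (sin (a + x) - sin a)" using 2 by simp
    then show ?thesis by (simp add: power2_eq_square algebra_simps)
  next
    case 3
    then have "cos (b + r) * (- x) \<le> sin (- a + - x) - sin (- a)"
      using pos[of "- a" "- x"] assms by simp
    also have "\<dots> = - (sin (a + x) - sin a)"
      using sin_minus[of "a + x"] by simp
    finally have "(- x) * (cos (b + r) * (- x)) \<le> (- x) * (- (sin (a + x) - sin a))"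
      using 3 by (intro mult_left_mono) auto
    then show ?thesis by (simp add: power2_eq_square algebra_simps)
  qed simp
qed

text \<open>
  For a vector of mean zero each entry \<open>v\<^sub>i\<close> is the average of the differences \<open>v\<^sub>i - v\<^sub>j\<close>, and two entries
  differ by at most the total variation along the path. The constant is far from optimal; stability
  only uses that there is one.
\<close>
lemma path_poincare_inequality:
  fixes v :: "nat \<Rightarrow> real"
  assumes zero: "(\<Sum>i<n. v i) = 0"
  shows "(\<Sum>i<n. (v i)\<^sup>2) \<le> (real n)\<^sup>2 * (\<Sum>i<n - 1. (v (Suc i) - v i)\<^sup>2)"
proof -
  define S where "S = (\<Sum>k<n - 1. \<bar>v (Suc k) - v k\<bar>)"
  define Q where "Q = (\<Sum>k<n - 1. (v (Suc k) - v k)\<^sup>2)"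
  have up: "\<bar>v j - v i\<bar> \<le> S" if "i \<le> j" "j < n" for i j
  proof -
    have "\<bar>v j - v i\<bar> = \<bar>\<Sum>k = i..<j. v (Suc k) - v k\<bar>"
      using that by (simp add: sum_Suc_diff')
    also have "\<dots> \<le> (\<Sum>k = i..<j. \<bar>v (Suc k) - v k\<bar>)" by (rule sum_abs)
    also have "\<dots> \<le> S" unfolding S_def using that by (intro sum_mono2) auto
    finally show ?thesis .
  qed
  have diff: "\<bar>v i - v j\<bar> \<le> S" if "i < n" "j < n" for i j
    using up[of i j] up[of j i] that by (cases "i \<le> j") (auto simp: abs_minus_commute)
  have S2: "S\<^sup>2 \<le> real n * Q"
  proof -
    have "S\<^sup>2 \<le> (\<Sum>k<n - 1. \<bar>v (Suc k) - v k\<bar>\<^sup>2) * (\<Sum>k<n - 1. 1\<^sup>2)"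
      unfolding S_def using Cauchy_Schwarz_ineq_sum[of "\<lambda>k. \<bar>v (Suc k) - v k\<bar>" "\<lambda>_. 1" "{..<n - 1}"]
      by simp
    also have "\<dots> = Q * real (n - 1)" by (simp add: Q_def)
    also have "\<dots> \<le> Q * real n" by (intro mult_left_mono) (auto simp: Q_def sum_nonneg)
    finally show ?thesis by (simp add: mult.commute)
  qed
  have "(v i)\<^sup>2 \<le> real n * Q" if "i < n" for i
  proof -
    have "real n * v i = (\<Sum>j<n. v i - v j)" using zero by (simp add: sum_subtractf)
    then have "real n * \<bar>v i\<bar> = \<bar>\<Sum>j<n. v i - v j\<bar>" by (metis abs_mult abs_of_nat)
    also have "\<dots> \<le> (\<Sum>j<n. \<bar>v i - v j\<bar>)" by (rule sum_abs)
    also have "\<dots> \<le> (\<Sum>j<n. S)" using diff that by (intro sum_mono) auto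
    finally have "\<bar>v i\<bar> \<le> S" using that by simp
    then have "(v i)\<^sup>2 \<le> S\<^sup>2" by (metis abs_ge_zero power2_abs power_mono)
    then show ?thesis using S2 by simp
  qed
  then have "(\<Sum>i<n. (v i)\<^sup>2) \<le> (\<Sum>i<n. real n * Q)" by (intro sum_mono) auto
  then show ?thesis by (simp add: Q_def power2_eq_square mult.assoc)
qed

lemma antisymmetric_double_sum:
  fixes v :: "nat \<Rightarrow> real"
  assumes "\<And>i j. i < n \<Longrightarrow> j < n \<Longrightarrow> h j i = - h i j"
  shows "(\<Sum>i<n. \<Sum>j<n. v i * h i j) = - (1 / 2) * (\<Sum>i<n. \<Sum>j<n. (v j - v i) * h i j)"
proof -
  have "(\<Sum>i<n. \<Sum>j<n. v j * h i j) = (\<Sum>j<n. \<Sum>i<n. v j * h i j)" by (rule sum.swap)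
  also have "\<dots> = (\<Sum>j<n. \<Sum>i<n. - (v j * h j i))"
  proof (intro sum.cong refl)
    fix i j assume "j \<in> {..<n}" "i \<in> {..<n}"
    then have "h i j = - h j i" by (intro assms) auto
    then show "v j * h i j = - (v j * h j i)" by simp
  qed
  also have "\<dots> = - (\<Sum>i<n. \<Sum>j<n. v i * h i j)" by (simp add: sum_negf)
  finally show ?thesis by (simp add: left_diff_distrib sum_subtractf)
qed

text \<open>
  The differential inequality is known only below the level \<open>R\<close>. A first crossing of that level is
  impossible, since \<open>V\<close> does not increase before it; so the inequality holds for all times and
  Gronwall's argument applies.
\<close>
lemma decay_below_level:
  fixes V V' :: "real \<Rightarrow> real"
  assumes deriv: "\<And>t. t \<ge> 0 \<Longrightarrow> (V has_real_derivative V' t) (at t within {0..})"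
    and decay: "\<And>t. t \<ge> 0 \<Longrightarrow> V t < R \<Longrightarrow> V' t \<le> - (l * V t)"
    and "V 0 < R" "l \<ge> 0" and nonneg: "\<And>t. V t \<ge> 0" and "T \<ge> 0"
  shows "V T \<le> V 0 * exp (- (l * T))"
proof -
  have cont: "continuous_on {0..t} V" for t
    by (rule continuous_on_subset[of "{0..}"])
       (auto simp: continuous_on_eq_continuous_within intro!: DERIV_continuous deriv)
  have deriv': "(V has_real_derivative V' t) (at t)" if "t > 0" for t
    using has_field_derivative_subset[OF deriv[of t], of "{0<..}"] that
    by (simp add: at_within_open[of t "{0<..}"] subset_iff)
  have below: "V t < R" if "t \<ge> 0" for t
  proof (rule ccontr)
    assume "\<not> V t < R"
    define S where "S = {0..t} \<inter> V -` {R..}"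
    have "closed S" unfolding S_def
      by (rule continuous_closed_preimage[OF cont]) auto
    moreover have "t \<in> S" using \<open>\<not> V t < R\<close> that by (auto simp: S_def)
    moreover have "bdd_below S" by (auto simp: S_def)
    ultimately have inS: "Inf S \<in> S" by (intro closed_contains_Inf) auto
    have before: "V s < R" if "0 \<le> s" "s < Inf S" for s
    proof (rule ccontr)
      assume "\<not> V s < R"
      then have "s \<in> S" using that inS by (auto simp: S_def)
      then show False using cInf_lower[OF _ \<open>bdd_below S\<close>] that by fastforce
    qed
    have "V (Inf S) \<le> V 0"
    proof (rule DERIV_nonpos_imp_decreasing_open[where f = V])
      fix x assume x: "0 < x" "x < Inf S"
      have "V' x \<le> - (l * V x)" using decay before x by auto
      also have "\<dots> \<le> 0" using nonneg[of x] \<open>l \<ge> 0\<close> by simp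
      finally show "\<exists>y. (V has_real_derivative y) (at x) \<and> y \<le> 0" using deriv' x by auto
    qed (use inS cont in \<open>auto simp: S_def\<close>)
    then show False using inS \<open>V 0 < R\<close> by (auto simp: S_def)
  qed
  have "V T * exp (l * T) \<le> V 0 * exp (l * 0)"
  proof (rule DERIV_nonpos_imp_decreasing_open[OF \<open>T \<ge> 0\<close>, where f = "\<lambda>t. V t * exp (l * t)"])
    fix x :: real assume x: "0 < x" "x < T"
    have "((\<lambda>t. V t * exp (l * t)) has_real_derivative (V' x + l * V x) * exp (l * x)) (at x)"
      using deriv'[OF x(1)] by (auto intro!: derivative_eq_intros simp: algebra_simps)
    moreover have "(V' x + l * V x) * exp (l * x) \<le> 0"
      using decay[of x] below[of x] x by (intro mult_nonpos_nonneg) auto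
    ultimately show "\<exists>y. ((\<lambda>t. V t * exp (l * t)) has_real_derivative y) (at x) \<and> y \<le> 0" by blast
  qed (intro continuous_intros cont)
  then have "V T \<le> V 0 / exp (l * T)" by (simp add: field_simps)
  then show ?thesis by (simp add: exp_minus divide_inverse)
qed

text \<open>
  Summation by parts over the edges turns the left-hand side into
  \<open>- 1 / 2 \<Sum>\<^bsub>i \<sim> j\<^esub> (v\<^sub>j - v\<^sub>i) (sin (u\<^sub>j - u\<^sub>i + v\<^sub>j - v\<^sub>i) - sin (u\<^sub>j - u\<^sub>i))\<close> with \<open>v = w - u\<close>. As all angles that
  occur stay below \<open>\<pi> / 2\<close>, each summand is at least a fixed positive multiple of \<open>(v\<^sub>j - v\<^sub>i)\<^sup>2\<close>, and the edges of the
  path alone control \<open>\<Sum> v\<^sub>i\<^sup>2\<close>.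
\<close>
lemma kuramoto_dissipation:
  assumes sym: "\<And>i j. i < n \<Longrightarrow> j < n \<Longrightarrow> adj i j \<Longrightarrow> adj j i"
    and path: "\<And>i. Suc i < n \<Longrightarrow> adj i (Suc i)"
    and equil: "\<And>i. i < n \<Longrightarrow> kuramoto_field n e adj u i = 0"
    and acute: "\<And>i j. i < n \<Longrightarrow> j < n \<Longrightarrow> adj i j \<Longrightarrow> \<exists>k::int. \<bar>u j - u i + 2 * pi * k\<bar> \<le> b"
    and "e > 0" "n > 0" "0 \<le> r" "b + 2 * r \<le> pi / 2"
    and zero: "(\<Sum>i<n. w i - u i) = 0"
    and close: "\<And>i. i < n \<Longrightarrow> \<bar>w i - u i\<bar> \<le> r"
  shows "(\<Sum>i<n. (w i - u i) * kuramoto_field n e adj w i)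
    \<le> - (pi / ((real n)\<^sup>2 * e ^ 3) * cos (b + 2 * r) / (2 * (real n)\<^sup>2) * (\<Sum>i<n. (w i - u i)\<^sup>2))"
proof -
  define v where "v i = w i - u i" for i
  define h where "h i j = (if adj i j then sin (w j - w i) - sin (u j - u i) else 0)" for i j
  define K where "K = pi / ((real n)\<^sup>2 * e ^ 3)"
  define m where "m = cos (b + 2 * r)"
  have "K \<ge> 0" using \<open>e > 0\<close> by (simp add: K_def)
  have "b \<ge> 0" if "Suc 0 < n" using acute[of 0 1] path[of 0] that by fastforce
  have "m \<ge> 0 \<or> n = 1"
  proof (cases "n = 1")
    case False
    then have "b \<ge> 0" using \<open>Suc 0 < n \<Longrightarrow> b \<ge> 0\<close> \<open>n > 0\<close> by simp
    then show ?thesis unfolding m_def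
      using \<open>0 \<le> r\<close> \<open>b + 2 * r \<le> pi / 2\<close> by (intro disjI1 cos_ge_zero) auto
  qed simp
  have field: "kuramoto_field n e adj w i = K * (\<Sum>j<n. h i j)" if "i < n" for i
  proof -
    have "kuramoto_field n e adj w i = kuramoto_field n e adj w i - kuramoto_field n e adj u i"
      using equil that by simp
    also have "\<dots> = K * (\<Sum>j | j < n \<and> adj i j. sin (w j - w i) - sin (u j - u i))"
      by (simp add: kuramoto_field_def K_def right_diff_distrib sum_subtractf)
    also have "(\<Sum>j | j < n \<and> adj i j. sin (w j - w i) - sin (u j - u i)) = (\<Sum>j<n. h i j)"
      unfolding h_def by (simp add: sum.inter_filter[symmetric])
    finally show ?thesis .
  qed
  have anti: "h j i = - h i j" if "i < n" "j < n" for i j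
    using sym[OF that] sym[OF that(2,1)] sin_minus[of "w j - w i"] sin_minus[of "u j - u i"]
    by (auto simp: h_def)
  have mono: "(if adj i j then m * (v j - v i)\<^sup>2 else 0) \<le> (v j - v i) * h i j"
    if ij: "i < n" "j < n" for i j
  proof (cases "adj i j")
    case True
    obtain k :: int where k: "\<bar>u j - u i + 2 * pi * k\<bar> \<le> b" using acute[OF ij True] by blast
    have "\<bar>v j - v i\<bar> \<le> 2 * r" using close[of i] close[of j] that by (auto simp: v_def)
    then have "m * (v j - v i)\<^sup>2 \<le> (v j - v i) *
        (sin ((u j - u i + 2 * pi * k) + (v j - v i)) - sin (u j - u i + 2 * pi * k))"
      unfolding m_def by (rule sin_increment_lower_bound[OF k]) (use \<open>b + 2 * r \<le> pi / 2\<close> pi_gt_zero in linarith)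
    moreover have "sin ((u j - u i + 2 * pi * k) + (v j - v i)) = sin (w j - w i)"
    proof -
      have "(u j - u i + 2 * pi * k) + (v j - v i) = (w j - w i) + 2 * pi * k" by (simp add: v_def)
      then show ?thesis by (simp only:) (simp add: sin_add[of "w j - w i"])
    qed
    moreover have "sin (u j - u i + 2 * pi * k) = sin (u j - u i)" by (simp add: sin_add[of "u j - u i"])
    ultimately show ?thesis using True by (simp add: h_def)
  qed (simp add: h_def)
  have edges: "(\<Sum>i<n - 1. m * (v (Suc i) - v i)\<^sup>2)
      \<le> (\<Sum>i<n. \<Sum>j<n. if adj i j then m * (v j - v i)\<^sup>2 else 0)" 
  proof (cases "n = 1")
    case True
    show ?thesis unfolding True by (auto intro!: sum_nonneg)
  next
    case False
    then have "m \<ge> 0" using \<open>m \<ge> 0 \<or> n = 1\<close> by simp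
    have "(\<Sum>i<n - 1. m * (v (Suc i) - v i)\<^sup>2)
        \<le> (\<Sum>i<n - 1. \<Sum>j<n. if adj i j then m * (v j - v i)\<^sup>2 else 0)"
    proof (rule sum_mono)
      fix i assume "i \<in> {..<n - 1}"
      then have i: "Suc i < n" by auto
      have "m * (v (Suc i) - v i)\<^sup>2 = (if adj i (Suc i) then m * (v (Suc i) - v i)\<^sup>2 else 0)"
        using path[OF i] by simp
      also have "\<dots> \<le> (\<Sum>j<n. if adj i j then m * (v j - v i)\<^sup>2 else 0)"
        by (rule member_le_sum) (use i \<open>m \<ge> 0\<close> in auto)
      finally show "m * (v (Suc i) - v i)\<^sup>2 \<le> \<dots>" .
    qed
    also have "\<dots> \<le> (\<Sum>i<n. \<Sum>j<n. if adj i j then m * (v j - v i)\<^sup>2 else 0)"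
      by (rule sum_mono2) (use \<open>m \<ge> 0\<close> in \<open>auto intro!: sum_nonneg\<close>)
    finally show ?thesis .
  qed
  have "m * (\<Sum>i<n. (v i)\<^sup>2) / (real n)\<^sup>2 \<le> (\<Sum>i<n - 1. m * (v (Suc i) - v i)\<^sup>2)"
  proof (cases "n = 1")
    case True
    then show ?thesis using zero by (simp add: v_def)
  next
    case False
    then have "m \<ge> 0" using \<open>m \<ge> 0 \<or> n = 1\<close> by simp
    have "(\<Sum>i<n. (v i)\<^sup>2) / (real n)\<^sup>2 \<le> (\<Sum>i<n - 1. (v (Suc i) - v i)\<^sup>2)"
      using path_poincare_inequality[of v n] zero \<open>n > 0\<close> by (simp add: v_def field_simps)
    from mult_left_mono[OF this \<open>m \<ge> 0\<close>] show ?thesis by (simp add: sum_distrib_left)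
  qed
  also note edges
  also have "(\<Sum>i<n. \<Sum>j<n. if adj i j then m * (v j - v i)\<^sup>2 else 0)
      \<le> (\<Sum>i<n. \<Sum>j<n. (v j - v i) * h i j)"
    by (intro sum_mono) (use mono in auto)
  finally have key: "m * (\<Sum>i<n. (v i)\<^sup>2) / (real n)\<^sup>2 \<le> (\<Sum>i<n. \<Sum>j<n. (v j - v i) * h i j)" .
  have "(\<Sum>i<n. v i * kuramoto_field n e adj w i) = K * (\<Sum>i<n. \<Sum>j<n. v i * h i j)"
    using field by (simp add: sum_distrib_left algebra_simps)
  also have "\<dots> = K * (- (1 / 2) * (\<Sum>i<n. \<Sum>j<n. (v j - v i) * h i j))"
    by (subst antisymmetric_double_sum[OF anti]) simp_all
  also have "\<dots> \<le> K * (- (1 / 2) * (m * (\<Sum>i<n. (v i)\<^sup>2) / (real n)\<^sup>2))"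
    using key by (intro mult_left_mono[OF _ \<open>K \<ge> 0\<close>]) simp
  finally show ?thesis by (simp add: v_def K_def m_def mult.assoc)
qed

text \<open>
  The squared distance to \<open>u\<close> is a Lyapunov function that decays exponentially near \<open>u\<close>. The
  hyperplane removes exactly the neutral direction of common shifts, along which nothing is dissipated.
\<close>
theorem acute_equilibrium_asymptotically_stable:
  assumes sym: "\<And>i j. i < n \<Longrightarrow> j < n \<Longrightarrow> adj i j \<Longrightarrow> adj j i"
    and path: "\<And>i. Suc i < n \<Longrightarrow> adj i (Suc i)"
    and equil: "equilibrium_on n (kuramoto_field n e adj) (zero_sum_hyperplane n) u"
    and acute: "\<And>i j. i < n \<Longrightarrow> j < n \<Longrightarrow> adj i j \<Longrightarrow> \<exists>k::int. \<bar>u j - u i + 2 * pi * k\<bar> \<le> b"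
    and "0 \<le> b" "b < pi / 2" and "e > 0" "n > 0"
  shows "asymptotically_stable_on n (kuramoto_field n e adj) (zero_sum_hyperplane n) u"
proof -
  let ?F = "kuramoto_field n e adj"
  \<comment> \<open>If every phase moves by at most \<open>r\<close>, differences move by at most \<open>2 r\<close> and stay below \<open>\<pi> / 2\<close>.\<close>
  define r where "r = (pi / 2 - b) / 4"
  define l where "l = pi / ((real n)\<^sup>2 * e ^ 3) * cos (b + 2 * r) / (real n)\<^sup>2"
  have "r > 0" and br: "b + 2 * r < pi / 2" using \<open>b < pi / 2\<close> by (auto simp: r_def field_simps)
  have "cos (b + 2 * r) > 0" using br \<open>r > 0\<close> \<open>0 \<le> b\<close> by (intro cos_gt_zero_pi) auto
  then have "l > 0" using \<open>e > 0\<close> \<open>n > 0\<close> by (simp add: l_def)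
  have decay: "vdist n (\<phi> T) u \<le> vdist n (\<phi> 0) u * exp (- (l * T / 2))"
    if sol: "solution_on n ?F (zero_sum_hyperplane n) \<phi>" and start: "vdist n (\<phi> 0) u < r" and "T \<ge> 0"
    for \<phi> T
  proof -
    define V where "V t = (\<Sum>i<n. (\<phi> t i - u i)\<^sup>2)" for t
    have V: "(vdist n (\<phi> t) u)\<^sup>2 = V t" for t
      by (simp add: vdist_def V_def L2_set_def sum_nonneg)
    have V0: "V t \<ge> 0" for t by (simp add: V_def sum_nonneg)
    define V' where "V' t = (\<Sum>i<n. 2 * ((\<phi> t i - u i) * ?F (\<phi> t) i))" for t
    have "V T \<le> V 0 * exp (- (l * T))"
    proof (rule decay_below_level[where R = "r\<^sup>2" and V' = V'])
      fix t :: real assume "t \<ge> 0"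
      then show "(V has_real_derivative V' t) (at t within {0..})"
        using sol unfolding V_def[abs_def] V'_def solution_on_def
        by (auto intro!: derivative_eq_intros simp: algebra_simps)
      assume less: "V t < r\<^sup>2"
      have close: "\<bar>\<phi> t i - u i\<bar> \<le> r" if "i < n" for i
      proof -
        have "(\<phi> t i - u i)\<^sup>2 \<le> V t" unfolding V_def
          by (rule member_le_sum) (use that in auto)
        then have "(\<phi> t i - u i)\<^sup>2 \<le> r\<^sup>2" using less by simp
        then show ?thesis using \<open>r > 0\<close> unfolding abs_le_square_iff[symmetric] by simp
      qed
      have zero: "(\<Sum>i<n. \<phi> t i - u i) = 0"
        using sol equil \<open>t \<ge> 0\<close>
        by (auto simp: solution_on_def equilibrium_on_def zero_sum_hyperplane_def sum_subtractf)
      have rest: "?F u i = 0" if "i < n" for i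
        using equil that by (simp add: equilibrium_on_def)
      have "(\<Sum>i<n. (\<phi> t i - u i) * ?F (\<phi> t) i)
          \<le> - (pi / ((real n)\<^sup>2 * e ^ 3) * cos (b + 2 * r) / (2 * (real n)\<^sup>2) * V t)"
        unfolding V_def
        by (rule kuramoto_dissipation[OF sym path rest acute \<open>e > 0\<close> \<open>n > 0\<close> _ _ zero close])
           (use \<open>r > 0\<close> br in simp_all)
      also have "\<dots> = - (l / 2 * V t)" by (simp add: l_def)
      finally have "(\<Sum>i<n. (\<phi> t i - u i) * ?F (\<phi> t) i) \<le> - (l / 2 * V t)" .
      then show "V' t \<le> - (l * V t)" by (simp add: V'_def sum_distrib_left[symmetric])
    next
      have "(vdist n (\<phi> 0) u)\<^sup>2 < r\<^sup>2"
        using start by (rule power_strict_mono) (simp_all add: vdist_def)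
      then show "V 0 < r\<^sup>2" by (simp only: V)
    qed (use V0 \<open>l > 0\<close> \<open>T \<ge> 0\<close> in simp_all)
    also have "\<dots> = (vdist n (\<phi> 0) u * exp (- (l * T / 2)))\<^sup>2"
      unfolding power_mult_distrib V unfolding power2_eq_square exp_add[symmetric] by simp
    finally show ?thesis
      unfolding V[symmetric] by (rule power2_le_imp_le) (simp add: vdist_def)
  qed
  have "lyapunov_stable_on n ?F (zero_sum_hyperplane n) u"
    unfolding lyapunov_stable_on_def
  proof (intro allI impI)
    fix d :: real assume "d > 0"
    have "vdist n (\<phi> t) u < d"
      if "solution_on n ?F (zero_sum_hyperplane n) \<phi>" "vdist n (\<phi> 0) u < min d r" "t \<ge> 0" for \<phi> t
    proof -
      have "vdist n (\<phi> t) u \<le> vdist n (\<phi> 0) u * exp (- (l * t / 2))" using decay that by auto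
      also have "\<dots> \<le> vdist n (\<phi> 0) u * 1"
        using \<open>l > 0\<close> \<open>t \<ge> 0\<close> by (intro mult_left_mono) (auto simp: vdist_def)
      finally show ?thesis using that by simp
    qed
    then show "\<exists>s>0. \<forall>\<phi>. solution_on n ?F (zero_sum_hyperplane n) \<phi> \<and> vdist n (\<phi> 0) u < s \<longrightarrow>
        (\<forall>t\<ge>0. vdist n (\<phi> t) u < d)"
      using \<open>d > 0\<close> \<open>r > 0\<close> by (intro exI[of _ "min d r"]) auto
  qed
  moreover have "attractive_on n ?F (zero_sum_hyperplane n) u"
    unfolding attractive_on_def
  proof (intro exI[of _ r] conjI allI impI)
    fix \<phi> assume "solution_on n ?F (zero_sum_hyperplane n) \<phi> \<and> vdist n (\<phi> 0) u < r"
    then have le: "\<forall>\<^sub>F t in at_top. vdist n (\<phi> t) u \<le> vdist n (\<phi> 0) u * exp (- (l * t / 2))"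
      using decay by (auto intro!: eventually_at_top_linorderI[of 0])
    have "filterlim (\<lambda>t. t * (l / 2)) at_top at_top"
      using \<open>l > 0\<close> by (intro filterlim_at_top_mult_tendsto_pos[OF tendsto_const]) (auto simp: filterlim_ident)
    then have "((\<lambda>t. vdist n (\<phi> 0) u * exp (- (t * (l / 2)))) \<longlongrightarrow> vdist n (\<phi> 0) u * 0) at_top"
      by (intro tendsto_intros filterlim_compose[OF exp_at_bot] filterlim_compose[OF filterlim_uminus_at_bot_at_top])
    then have lim: "((\<lambda>t. vdist n (\<phi> 0) u * exp (- (l * t / 2))) \<longlongrightarrow> 0) at_top"
      by (simp add: mult.commute)
    show "((\<lambda>t. vdist n (\<phi> t) u) \<longlongrightarrow> 0) at_top"
      by (rule tendsto_sandwich[OF _ le tendsto_const lim]) (simp add: vdist_def)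
  qed (use \<open>r > 0\<close> in simp)
  ultimately show ?thesis using equil by (simp add: asymptotically_stable_on_def)
qed

section \<open>Equilibria as interior minimisers of the energy\<close>

definition energy :: "nat \<Rightarrow> (nat \<Rightarrow> nat \<Rightarrow> bool) \<Rightarrow> (nat \<Rightarrow> real) \<Rightarrow> real" where
  "energy n adj u = (\<Sum>i<n. \<Sum>j<n. if adj i j then 1 - cos (u j - u i) else 0)"

text \<open>
  Phases are real numbers, but the forces depend on differences modulo \<open>2 \<pi>\<close>. The shifts \<open>c\<close>, multiples of
  \<open>2 \<pi>\<close> in all uses, select which representative of each difference is required to be small; this is how
  a winding number is prescribed.
\<close>
definition window ::
  "nat \<Rightarrow> (nat \<Rightarrow> nat \<Rightarrow> bool) \<Rightarrow> (nat \<Rightarrow> nat \<Rightarrow> real) \<Rightarrow> real \<Rightarrow> (nat \<Rightarrow> real) set" where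
  "window n adj c b = {u. \<forall>i<n. \<forall>j<n. adj i j \<longrightarrow> \<bar>u j - u i + c i j\<bar> \<le> b}"

lemma energy_cong: "(\<And>i. i < n \<Longrightarrow> u i = v i) \<Longrightarrow> energy n adj u = energy n adj v"
  unfolding energy_def by (intro sum.cong refl if_cong) auto

lemma energy_shift: "energy n adj (\<lambda>i. u i - a) = energy n adj u"
proof -
  have "u j - a - (u i - a) = u j - u i" for i j by simp
  then show ?thesis by (simp only: energy_def)
qed

text \<open>
  The field is, up to a positive factor, minus the gradient of the energy. Each edge occurs twice in the energy,
  once in each direction, and both occurrences contribute equally to the derivative.
\<close>
lemma stationary_of_coordinate_minimum:
  assumes sym: "\<And>i j. i < n \<Longrightarrow> j < n \<Longrightarrow> adj i j \<Longrightarrow> adj j i"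
    and "k < n" "d > 0"
    and min: "\<And>t. \<bar>t\<bar> < d \<Longrightarrow> energy n adj u \<le> energy n adj (u(k := u k + t))"
  shows "kuramoto_field n e adj u k = 0"
proof -
  let ?s = "\<lambda>j i. of_bool (j = k) - of_bool (i = k) :: real"
  let ?D = "\<Sum>i<n. \<Sum>j<n. if adj i j then sin (u j - u i) * ?s j i else 0"
  have eq: "energy n adj (u(k := u k + t))
      = (\<Sum>i<n. \<Sum>j<n. if adj i j then 1 - cos (u j - u i + ?s j i * t) else 0)" for t
    unfolding energy_def
    by (intro sum.cong refl if_cong arg_cong2[of _ _ _ _ "(-)"] arg_cong[of _ _ cos]) auto
  have "((\<lambda>t. energy n adj (u(k := u k + t))) has_real_derivative ?D) (at 0)"
    unfolding eq
  proof (intro DERIV_sum)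
    fix i j
    show "((\<lambda>t. if adj i j then 1 - cos (u j - u i + ?s j i * t) else 0) has_real_derivative
        (if adj i j then sin (u j - u i) * ?s j i else 0)) (at 0)"
      by (cases "adj i j") (auto intro!: derivative_eq_intros)
  qed
  then have "?D = 0"
    by (rule DERIV_local_min[OF _ \<open>d > 0\<close>]) (use min in auto)
  have "?D = (\<Sum>i<n. \<Sum>j<n. if j = k then (if adj i k then sin (u k - u i) else 0) else 0)
      - (\<Sum>i<n. if i = k then (\<Sum>j<n. if adj k j then sin (u j - u k) else 0) else 0)"
    unfolding sum_subtractf[symmetric]
  proof (intro sum.cong refl)
    fix i assume "i \<in> {..<n}"
    have "(\<Sum>j<n. if adj i j then sin (u j - u i) * ?s j i else 0)
       = (\<Sum>j<n. (if j = k then (if adj i k then sin (u k - u i) else 0) else 0)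
           - (if i = k then (if adj k j then sin (u j - u k) else 0) else 0))"
      by (intro sum.cong) auto
    then show "(\<Sum>j<n. if adj i j then sin (u j - u i) * ?s j i else 0)
       = (\<Sum>j<n. if j = k then (if adj i k then sin (u k - u i) else 0) else 0)
           - (if i = k then (\<Sum>j<n. if adj k j then sin (u j - u k) else 0) else 0)"
      by (simp only: sum_subtractf) simp
  qed
  also have "(\<Sum>i<n. \<Sum>j<n. if j = k then (if adj i k then sin (u k - u i) else 0) else 0)
      = (\<Sum>i<n. if adj i k then sin (u k - u i) else 0)"
    using \<open>k < n\<close> by simp
  also have "\<dots> = (\<Sum>i<n. - (if adj k i then sin (u i - u k) else 0))"
  proof (intro sum.cong refl)
    fix i assume i: "i \<in> {..<n}"
    have "adj i k = adj k i" using sym[of i k] sym[of k i] i \<open>k < n\<close> by auto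
    then show "(if adj i k then sin (u k - u i) else 0) = - (if adj k i then sin (u i - u k) else 0)"
      using sin_minus[of "u i - u k"] by simp
  qed
  also have "\<dots> = - (\<Sum>j<n. if adj k j then sin (u j - u k) else 0)" by (rule sum_negf)
  also have "(\<Sum>i<n. if i = k then (\<Sum>j<n. if adj k j then sin (u j - u k) else 0) else 0)
      = (\<Sum>j<n. if adj k j then sin (u j - u k) else 0)"
    using \<open>k < n\<close> by simp
  finally have "(\<Sum>j<n. if adj k j then sin (u j - u k) else 0) = 0" using \<open>?D = 0\<close> by linarith
  then have "(\<Sum>j | j < n \<and> adj k j. sin (u j - u k)) = 0"
    using sum.inter_filter[of "{..<n}" "\<lambda>j. sin (u j - u k)" "adj k"] by simp
  then show ?thesis by (simp add: kuramoto_field_def)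
qed

text \<open>
  Neither the energy nor the window changes under a common shift, so the phase of node \<open>0\<close> may be pinned
  to \<open>0\<close>. Following the path, all other phases are then bounded, and what remains is compact.
\<close>
lemma energy_attains_minimum_on_window:
  assumes path: "\<And>i. Suc i < n \<Longrightarrow> adj i (Suc i)"
    and "u\<^sub>0 \<in> window n adj c b" and "0 \<le> b"
  obtains u where "u \<in> window n adj c b"
    and "\<And>v. v \<in> window n adj c b \<Longrightarrow> energy n adj u \<le> energy n adj v"
proof -
  define B where "B = (\<Sum>i<n. b + \<bar>c i (Suc i)\<bar>)"
  \<comment> \<open>Coordinates beyond \<open>n\<close> are irrelevant for the energy; they are set to \<open>0\<close> to get a compact product.\<close>
  define box where "box k = (if k < n then {- B..B} else {0 :: real})" for k :: nat
  define K where "K = PiE UNIV box \<inter> window n adj c b"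
  define pin where "pin v = (\<lambda>k. if k < n then v k - v 0 else 0 :: real)" for v :: "nat \<Rightarrow> real"
  have coord: "continuous_on UNIV (\<lambda>u. u k)" for k :: nat
    by (rule continuous_on_product_coordinates)
  have pin: "pin v \<in> K" "energy n adj (pin v) = energy n adj v"
    if v: "v \<in> window n adj c b" for v
  proof -
    have dist: "\<bar>v k - v 0\<bar> \<le> (\<Sum>i<k. b + \<bar>c i (Suc i)\<bar>)" if "k < n" for k
      using that
    proof (induction k)
      case (Suc k)
      have "\<bar>v (Suc k) - v k + c k (Suc k)\<bar> \<le> b"
        using v path Suc.prems by (auto simp: window_def)
      then show ?case using Suc by simp
    qed simp
    have "\<bar>pin v k\<bar> \<le> B" if "k < n" for k
    proof -
      have "(\<Sum>i<k. b + \<bar>c i (Suc i)\<bar>) \<le> B"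
        unfolding B_def using that \<open>0 \<le> b\<close> by (intro sum_mono2) auto
      then show ?thesis using dist[OF that] that by (simp add: pin_def)
    qed
    then have "pin v k \<in> box k" for k
      using abs_le_iff[of "pin v k" B] by (cases "k < n") (force simp: box_def pin_def)+
    then have "pin v \<in> PiE UNIV box" by auto
    then show "pin v \<in> K" using v by (auto simp: K_def window_def pin_def)
    have "energy n adj (pin v) = energy n adj (\<lambda>k. v k - v 0)"
      by (rule energy_cong) (simp add: pin_def)
    then show "energy n adj (pin v) = energy n adj v" by (simp add: energy_shift)
  qed
  have "closed (window n adj c b)"
  proof -
    have "window n adj c b = (\<Inter>i\<in>{..<n}. \<Inter>j\<in>{j. j < n \<and> adj i j}. {u. \<bar>u j - u i + c i j\<bar> \<le> b})"
      by (auto simp: window_def)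
    moreover have "closed {u. \<bar>u j - u i + c i j\<bar> \<le> b}" for i j
      by (intro closed_Collect_le continuous_intros coord)
    ultimately show ?thesis by (auto intro!: closed_INT)
  qed
  moreover have "compact (PiE UNIV box)"
  proof -
    have "compactin (product_topology (\<lambda>_. euclidean) UNIV) (PiE UNIV box)"
      by (subst compactin_PiE) (auto simp: box_def)
    then show ?thesis by (simp add: euclidean_product_topology)
  qed
  ultimately have "compact K" unfolding K_def by (rule compact_Int_closed[rotated])
  moreover have "K \<noteq> {}" using pin(1)[OF assms(2)] by auto
  moreover have "continuous_on K (energy n adj)"
  proof (rule continuous_on_subset[OF _ subset_UNIV])
    have "continuous_on UNIV (\<lambda>u. if adj i j then 1 - cos (u j - u i) else 0 :: real)" for i j
      by (cases "adj i j") (auto intro!: continuous_intros coord)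
    then show "continuous_on UNIV (energy n adj)"
      unfolding energy_def[abs_def] by (intro continuous_on_sum)
  qed
  ultimately obtain u where "u \<in> K" and min: "\<And>v. v \<in> K \<Longrightarrow> energy n adj u \<le> energy n adj v"
    using continuous_attains_inf by metis
  show ?thesis
  proof (rule that[of u])
    show "u \<in> window n adj c b" using \<open>u \<in> K\<close> by (simp add: K_def)
    show "energy n adj u \<le> energy n adj v" if "v \<in> window n adj c b" for v
      using min pin[OF that] by fastforce
  qed
qed

text \<open>
  The a priori bound keeps a minimiser away from the boundary of the window, so that single coordinates can
  be varied freely. Coordinate variations leave the zero-sum hyperplane; this is harmless since the energy is
  invariant under shifts, and the mean is subtracted only at the end.
\<close>
theorem interior_minimiser_is_equilibrium:
  assumes sym: "\<And>i j. i < n \<Longrightarrow> j < n \<Longrightarrow> adj i j \<Longrightarrow> adj j i"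
    and path: "\<And>i. Suc i < n \<Longrightarrow> adj i (Suc i)"
    and start: "u\<^sub>0 \<in> window n adj c b" and "0 \<le> b"
    and apriori: "\<And>u. u \<in> window n adj c b \<Longrightarrow> energy n adj u \<le> energy n adj u\<^sub>0
        \<Longrightarrow> u \<in> window n adj c \<rho>" and "\<rho> < b" and "n > 0"
  obtains u where "equilibrium_on n (kuramoto_field n e adj) (zero_sum_hyperplane n) u"
    and "u \<in> window n adj c \<rho>"
proof -
  obtain u where u: "u \<in> window n adj c b"
    and min: "\<And>v. v \<in> window n adj c b \<Longrightarrow> energy n adj u \<le> energy n adj v"
    using energy_attains_minimum_on_window[OF path start \<open>0 \<le> b\<close>] by blast
  have inner: "u \<in> window n adj c \<rho>" using apriori u min start by blast
  have stat: "kuramoto_field n e adj u k = 0" if "k < n" for k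
  proof (rule stationary_of_coordinate_minimum[OF sym that])
    show "b - \<rho> > 0" using \<open>\<rho> < b\<close> by simp
    fix t :: real assume t: "\<bar>t\<bar> < b - \<rho>"
    have "u(k := u k + t) \<in> window n adj c b"
      unfolding window_def
    proof (intro CollectI allI impI)
      fix i j assume ij: "i < n" "j < n" "adj i j"
      then have "\<bar>u j - u i + c i j\<bar> \<le> \<rho>" using inner by (simp add: window_def)
      then show "\<bar>(u(k := u k + t)) j - (u(k := u k + t)) i + c i j\<bar> \<le> b" using t by auto
    qed
    then show "energy n adj u \<le> energy n adj (u(k := u k + t))" by (rule min)
  qed
  define a where "a = (\<Sum>i<n. u i) / n"
  show ?thesis
  proof (rule that[of "\<lambda>i. u i - a"])
    show "(\<lambda>i. u i - a) \<in> window n adj c \<rho>" using inner by (simp add: window_def)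
    show "equilibrium_on n (kuramoto_field n e adj) (zero_sum_hyperplane n) (\<lambda>i. u i - a)"
    proof -
      have "u j - a - (u i - a) = u j - u i" for i j by simp
      then have "kuramoto_field n e adj (\<lambda>i. u i - a) = kuramoto_field n e adj u"
        by (simp only: kuramoto_field_def[abs_def])
      then show ?thesis using stat \<open>n > 0\<close>
        by (simp add: equilibrium_on_def zero_sum_hyperplane_def sum_subtractf a_def)
    qed
  qed
qed

section \<open>Energy bounds\<close>

lemma one_minus_cos_le: "1 - cos x \<le> x\<^sup>2 / 2" for x :: real
proof -
  have "\<bar>sin (x / 2)\<bar>\<^sup>2 \<le> \<bar>x / 2\<bar>\<^sup>2" by (intro power_mono abs_sin_x_le_abs_x) simp
  then show ?thesis using cos_double_sin[of "x / 2"] by (simp add: power_divide)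
qed

lemma one_minus_cos_ge:
  fixes x :: real
  assumes "\<bar>x\<bar> \<le> 2 * pi / 3"
  shows "x\<^sup>2 / 8 \<le> 1 - cos x"
proof -
  have "cos (0 + pi / 3) * (x / 2)\<^sup>2 \<le> (x / 2) * (sin (0 + x / 2) - sin 0)"
    by (rule sin_increment_lower_bound) (use assms in auto)
  then have "\<bar>x / 4\<bar> * \<bar>x / 2\<bar> \<le> \<bar>x / 2\<bar> * \<bar>sin (x / 2)\<bar>"
    unfolding abs_mult[symmetric] by (simp add: cos_60 power2_eq_square)
  then have "\<bar>x / 2\<bar> * \<bar>x / 4\<bar> \<le> \<bar>x / 2\<bar> * \<bar>sin (x / 2)\<bar>" by (simp only: mult.commute)
  then have "\<bar>x / 4\<bar> \<le> \<bar>sin (x / 2)\<bar>"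
    using mult_left_le_imp_le[of "\<bar>x / 2\<bar>" "\<bar>x / 4\<bar>" "\<bar>sin (x / 2)\<bar>"] by (cases "x = 0") (simp, linarith)
  then have "(x / 4)\<^sup>2 \<le> (sin (x / 2))\<^sup>2" by (simp only: abs_le_square_iff)
  then show ?thesis using cos_double_sin[of "x / 2"] by (simp add: power_divide)
qed

text \<open>
  Every common neighbour \<open>k\<close> splits the lifted difference along the edge into two, at least one
  of which carries at least half of it. Thus a stretched edge costs energy in proportion to the
  number of its common neighbours. The ends \<open>i\<close> and \<open>j\<close> themselves may belong to \<open>N\<close>, as a
  degenerate pair has difference \<open>0\<close>.
\<close>
lemma edge_bounded_by_energy:
  assumes u: "u \<in> window n adj c b" and "b \<le> 2 * pi / 3"
    and c: "\<And>i j. i < n \<Longrightarrow> j < n \<Longrightarrow> \<exists>z::int. c i j = 2 * pi * z" "\<And>i. i < n \<Longrightarrow> c i i = 0"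
    and ij: "i < n" "j < n"
    and N: "N \<subseteq> {..<n}"
      "\<And>k. k \<in> N \<Longrightarrow> k = i \<or> adj i k" "\<And>k. k \<in> N \<Longrightarrow> k = j \<or> adj k j"
      "\<And>k. k \<in> N \<Longrightarrow> c i j = c i k + c k j"
  shows "real (card N) * (u j - u i + c i j)\<^sup>2 \<le> 32 * energy n adj u"
proof -
  define \<delta> where "\<delta> i j = u j - u i + c i j" for i j
  define f where "f i j = (if adj i j then 1 - cos (u j - u i) else 0)" for i j
  have f0: "f i j \<ge> 0" for i j by (simp add: f_def)
  have fge: "(\<delta> i j)\<^sup>2 / 8 \<le> f i j" if edge: "i < n" "j < n" "j = i \<or> adj i j" for i j
  proof -
    obtain z :: int where z: "c i j = 2 * pi * z" using c(1) edge by blast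
    have "cos (u j - u i) = cos (\<delta> i j)" by (simp add: \<delta>_def z cos_add[of "u j - u i"])
    moreover have "\<bar>\<delta> i j\<bar> \<le> 2 * pi / 3" if "adj i j"
      using u \<open>i < n\<close> \<open>j < n\<close> that \<open>b \<le> 2 * pi / 3\<close> by (fastforce simp: window_def \<delta>_def)
    ultimately show ?thesis
      using one_minus_cos_ge[of "\<delta> i j"] edge c(2) by (auto simp: f_def \<delta>_def)
  qed
  have "(\<delta> i j)\<^sup>2 / 16 \<le> f i k + f k j" if k: "k \<in> N" for k
  proof -
    have "\<delta> i j = \<delta> i k + \<delta> k j" using N(4)[OF k] by (simp add: \<delta>_def)
    then have "(\<delta> i j)\<^sup>2 \<le> 2 * ((\<delta> i k)\<^sup>2 + (\<delta> k j)\<^sup>2)"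
      using sum_squares_bound[of "\<delta> i k" "\<delta> k j"] by (simp add: power2_sum)
    moreover have "k < n" using N(1) k by auto
    moreover have "(\<delta> i k)\<^sup>2 / 8 \<le> f i k" using \<open>k < n\<close> ij N(2)[OF k] by (intro fge) auto
    moreover have "(\<delta> k j)\<^sup>2 / 8 \<le> f k j" using \<open>k < n\<close> ij N(3)[OF k] by (intro fge) auto
    ultimately show ?thesis by argo
  qed
  then have "(\<Sum>k\<in>N. (\<delta> i j)\<^sup>2 / 16) \<le> (\<Sum>k\<in>N. f i k) + (\<Sum>k\<in>N. f k j)"
    unfolding sum.distrib[symmetric] by (rule sum_mono)
  \<comment> \<open>The two sums are part of row \<open>i\<close> and of column \<open>j\<close>, each bounded by the whole energy.\<close>
  also have "\<dots> \<le> (\<Sum>k<n. f i k) + (\<Sum>k<n. f k j)"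
    using N(1) f0 by (intro add_mono sum_mono2) auto
  also have "(\<Sum>k<n. f i k) \<le> (\<Sum>i<n. \<Sum>k<n. f i k)"
    by (rule member_le_sum[of i _ "\<lambda>i. \<Sum>k<n. f i k"]) (use ij f0 in \<open>auto intro!: sum_nonneg\<close>)
  also have "(\<Sum>k<n. f k j) \<le> (\<Sum>k<n. \<Sum>j<n. f k j)"
    by (intro sum_mono member_le_sum) (use ij f0 in auto)
  finally show ?thesis by (simp add: energy_def f_def \<delta>_def)
qed

lemma energy_upper_bound:
  assumes c: "\<And>i j. i < n \<Longrightarrow> j < n \<Longrightarrow> \<exists>z::int. c i j = 2 * pi * z"
    and u: "u \<in> window n adj c a" and deg: "\<And>i. i < n \<Longrightarrow> real (card {j. j < n \<and> adj i j}) \<le> D"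
    and "0 \<le> a"
  shows "energy n adj u \<le> real n * D * a\<^sup>2 / 2"
proof -
  have "(\<Sum>j<n. if adj i j then 1 - cos (u j - u i) else 0) \<le> D * (a\<^sup>2 / 2)" if i: "i < n" for i
  proof -
    have "(\<Sum>j<n. if adj i j then 1 - cos (u j - u i) else 0) \<le> (\<Sum>j<n. if adj i j then a\<^sup>2 / 2 else 0)"
    proof (rule sum_mono)
      fix j assume j: "j \<in> {..<n}"
      obtain z :: int where z: "c i j = 2 * pi * z" using c[OF i] j by blast
      have "1 - cos (u j - u i) \<le> a\<^sup>2 / 2" if adj: "adj i j"
      proof -
        have "\<bar>u j - u i + c i j\<bar> \<le> a" using u \<open>i < n\<close> j adj by (simp add: window_def)
        then have "(u j - u i + c i j)\<^sup>2 \<le> a\<^sup>2" using \<open>0 \<le> a\<close> by (simp add: abs_le_square_iff[symmetric])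
        moreover have "cos (u j - u i) = cos (u j - u i + c i j)" by (simp add: z cos_add[of "u j - u i"])
        ultimately show ?thesis using one_minus_cos_le[of "u j - u i + c i j"] by simp
      qed
      then show "(if adj i j then 1 - cos (u j - u i) else 0) \<le> (if adj i j then a\<^sup>2 / 2 else 0)" by simp
    qed
    also have "\<dots> = real (card {j. j < n \<and> adj i j}) * (a\<^sup>2 / 2)"
      using sum.inter_filter[of "{..<n}" "\<lambda>j. a\<^sup>2 / 2" "adj i"] by simp
    also have "\<dots> \<le> D * (a\<^sup>2 / 2)" using deg[OF that] by (intro mult_right_mono) auto
    finally show ?thesis .
  qed
  then have "energy n adj u \<le> (\<Sum>i<n. D * (a\<^sup>2 / 2))" unfolding energy_def by (intro sum_mono) auto
  then show ?thesis by simp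
qed

section \<open>Angles modulo a full turn\<close>

text \<open>
  The relation of being at geodesic distance less than \<open>r\<close>, expressed by arguments of points. For radii up to
  \<open>\<pi>\<close> it agrees with \<^const>\<open>geodesic_dist\<close>; in this form rotation invariance, the triangle inequality and
  midpoints are elementary.
\<close>
definition near :: "real \<Rightarrow> real \<Rightarrow> real \<Rightarrow> bool" where
  "near r a b \<longleftrightarrow> (\<exists>z::int. \<bar>a - b + 2 * pi * z\<bar> < r)"

lemma near_sym: "near r a b \<Longrightarrow> near r b a"
proof -
  assume "near r a b"
  then obtain z :: int where "\<bar>a - b + 2 * pi * z\<bar> < r" by (auto simp: near_def)
  then have "\<bar>b - a + 2 * pi * of_int (- z)\<bar> < r" by (simp add: abs_minus_commute algebra_simps)
  then show ?thesis unfolding near_def by blast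
qed

lemma near_trans: "near r a b \<Longrightarrow> near s b c \<Longrightarrow> near (r + s) a c"
proof -
  assume "near r a b" "near s b c"
  then obtain y z :: int where "\<bar>a - b + 2 * pi * y\<bar> < r" "\<bar>b - c + 2 * pi * z\<bar> < s"
    by (auto simp: near_def)
  then have "\<bar>(a - b + 2 * pi * y) + (b - c + 2 * pi * z)\<bar> < r + s" by linarith
  then have "\<bar>a - c + 2 * pi * of_int (y + z)\<bar> < r + s" by (simp add: algebra_simps)
  then show ?thesis unfolding near_def by blast
qed



lemma near_midpoint: "near r a b \<Longrightarrow> \<exists>p. near (r / 2) p a \<and> near (r / 2) p b"
proof -
  assume "near r a b"
  then obtain z :: int where z: "\<bar>a - b + 2 * pi * z\<bar> < r" by (auto simp: near_def)
  define p where "p = (a + 2 * pi * z + b) / 2"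
  have "\<bar>p - b + 2 * pi * of_int 0\<bar> < r / 2" using z by (simp add: p_def field_simps)
  moreover have "\<bar>p - a + 2 * pi * of_int (- z)\<bar> < r / 2" using z by (simp add: p_def field_simps)
  ultimately show ?thesis unfolding near_def by blast
qed

lemma int_multiple_of_period_small:
  fixes z :: int
  assumes "\<bar>2 * pi * z\<bar> < 2 * pi"
  shows "z = 0"
proof -
  have "2 * pi * \<bar>real_of_int z\<bar> < 2 * pi * 1" using assms by (simp add: abs_mult)
  then have "\<bar>real_of_int z\<bar> < 1" using mult_less_cancel_left_pos[of "2 * pi"] by simp
  then show ?thesis by linarith
qed

lemma angle_diff_eqI:
  assumes "\<bar>a - b + 2 * pi * of_int z\<bar> < pi"
  shows "angle_diff a b = a - b + 2 * pi * of_int z"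
  unfolding angle_diff_def
proof (rule the_equality)
  show "- pi < a - b + 2 * pi * of_int z \<and> a - b + 2 * pi * of_int z < pi \<and>
      (\<exists>k::int. a - b + 2 * pi * of_int z = a - b + 2 * pi * of_int k)"
    using assms by auto
  fix r assume r: "- pi < r \<and> r < pi \<and> (\<exists>k::int. r = a - b + 2 * pi * of_int k)"
  then obtain k :: int where k: "r = a - b + 2 * pi * of_int k" by auto
  have "\<bar>2 * pi * of_int (k - z)\<bar> < 2 * pi" using r k assms by (simp add: algebra_simps) linarith
  then have "k - z = 0" by (rule int_multiple_of_period_small)
  then show "r = a - b + 2 * pi * of_int z" using k by simp
qed

lemma near_angle_diff:
  assumes "near r a b" "r \<le> pi"
  obtains z :: int where "angle_diff a b = a - b + 2 * pi * z" "\<bar>angle_diff a b\<bar> < r"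
proof -
  obtain z :: int where z: "\<bar>a - b + 2 * pi * z\<bar> < r" using assms by (auto simp: near_def)
  then have "angle_diff a b = a - b + 2 * pi * z" using assms by (intro angle_diff_eqI) auto
  then show ?thesis using z that by simp
qed

text \<open>
  The defect of additivity is a multiple of \<open>2 \<pi>\<close> smaller than \<open>3 r \<le> 2 \<pi>\<close>: a triangle of
  neighbours does not wind around the circle.
\<close>
lemma angle_diff_add:
  assumes "near r a b" "near r b c" "near r a c" "3 * r \<le> 2 * pi"
  shows "angle_diff a c = angle_diff a b + angle_diff b c"
proof -
  have "r \<le> pi" using assms(4) pi_gt_zero by linarith
  obtain x where x: "angle_diff a b = a - b + 2 * pi * of_int x" "\<bar>angle_diff a b\<bar> < r"
    using near_angle_diff[OF assms(1) \<open>r \<le> pi\<close>] .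
  obtain y where y: "angle_diff b c = b - c + 2 * pi * of_int y" "\<bar>angle_diff b c\<bar> < r"
    using near_angle_diff[OF assms(2) \<open>r \<le> pi\<close>] .
  obtain z where z: "angle_diff a c = a - c + 2 * pi * of_int z" "\<bar>angle_diff a c\<bar> < r"
    using near_angle_diff[OF assms(3) \<open>r \<le> pi\<close>] .
  have eq: "angle_diff a b + angle_diff b c - angle_diff a c = 2 * pi * of_int (x + y - z)"
    by (simp add: x(1) y(1) z(1) algebra_simps)
  have "\<bar>2 * pi * of_int (x + y - z)\<bar> < 2 * pi"
    unfolding eq[symmetric] using x(2) y(2) z(2) assms(4) by linarith
  then have "x + y - z = 0" by (rule int_multiple_of_period_small)
  then show ?thesis using eq by simp
qed

section \<open>Twisted equilibria on evenly spread nodes\<close>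

lemma cyclic_sum_shift: "(\<Sum>i<n. f (Suc i mod n)) = (\<Sum>i<n. f i)"
  for f :: "nat \<Rightarrow> 'a::comm_monoid_add"
proof (cases n)
  case (Suc m)
  have "(\<Sum>i<m. f (Suc i mod n)) = (\<Sum>i<m. f (Suc i))"
    by (intro sum.cong) (auto simp: Suc)
  then show ?thesis
    unfolding Suc by (subst sum.lessThan_Suc, subst sum.lessThan_Suc_shift) (simp add: Suc add.commute)
qed simp

text \<open>
  The correction that makes the step from node \<open>i\<close> to its successor a nonnegative angle: the
  last step, back to node \<open>0\<close>, completes the full turn.
\<close>
definition turn :: "nat \<Rightarrow> nat \<Rightarrow> real" where
  "turn n i = (if Suc i < n then 0 else 2 * pi)"

text \<open>
  Otherwise the ball of radius \<open>r / 2\<close> around the point \<open>\<theta> i + r / 2\<close> would fit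
  between two consecutive nodes and contain no node.
\<close>
lemma consecutive_gap:
  fixes \<theta> :: "nat \<Rightarrow> real"
  assumes mono: "\<And>i j. i \<le> j \<Longrightarrow> j < n \<Longrightarrow> \<theta> i \<le> \<theta> j"
    and range: "\<And>i. i < n \<Longrightarrow> 0 \<le> \<theta> i \<and> \<theta> i < 2 * pi"
    and cover: "\<And>p. \<exists>k<n. near (r / 2) (\<theta> k) p"
    and i: "i < n"
  shows "\<theta> (Suc i mod n) - \<theta> i + turn n i < r"
proof (rule ccontr)
  define succ where "succ = \<theta> (Suc i mod n) + turn n i"
  assume "\<not> \<theta> (Suc i mod n) - \<theta> i + turn n i < r"
  then have large: "\<theta> i + r \<le> succ" by (simp add: succ_def)
  obtain k and z :: int where k: "k < n" "\<bar>\<theta> k - (\<theta> i + r / 2) + 2 * pi * z\<bar> < r / 2"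
    using cover unfolding near_def by blast
  then have btw: "\<theta> i < \<theta> k + 2 * pi * z" "\<theta> k + 2 * pi * z < succ" using large by linarith+
  \<comment> \<open>A representative of \<open>\<theta> k\<close> strictly between \<open>\<theta> i\<close> and its successor lies in one period, so \<open>z = 0\<close>.\<close>
  have "succ \<le> \<theta> 0 + 2 * pi"
  proof (cases "Suc i < n")
    case True
    then show ?thesis using range[of "Suc i"] range[of 0] i by (auto simp: succ_def turn_def)
  next
    case False
    then have "Suc i = n" using i by simp
    then show ?thesis by (simp add: succ_def turn_def)
  qed
  moreover have "\<theta> 0 \<le> \<theta> k" using mono[of 0 k] k(1) by simp
  ultimately have "2 * pi * of_int z < 2 * pi * 1" using btw by linarith
  then have "z < 1" by simp
  have "2 * pi * (- 1) < 2 * pi * of_int z"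
    using btw(1) range[OF k(1)] range[OF i] by linarith
  then have "- 1 < real_of_int z" using mult_less_cancel_left_pos[of "2 * pi" "- 1" "of_int z"] by simp
  then have "z = 0" using \<open>z < 1\<close> by simp
  show False
  proof (cases "k \<le> i")
    case True
    then show False using mono[of k i] i btw(1) \<open>z = 0\<close> by simp
  next
    case False
    then have "Suc i < n" "Suc i \<le> k" using k(1) by auto
    then show False using mono[of "Suc i" k] k(1) btw(2) \<open>z = 0\<close> by (simp add: succ_def turn_def)
  qed
qed

text \<open>
  The deterministic core. The numbers \<open>m\<close> and \<open>D\<close> enter through their ratio: the lifted differences of
  the minimiser are at most \<open>\<rho>\<close> with \<open>\<rho>\<^sup>2 = 16 n D (q r)\<^sup>2 / m\<close>, and \<open>small\<close> says that \<open>\<rho>\<close> is less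
  than \<open>\<pi> / 3\<close>, the size of the window. The window lies inside \<open>2 \<pi> / 3\<close>, where the quadratic lower
  bound for \<open>1 - cos\<close> holds, and below \<open>\<pi> / 2\<close>, where equilibria are stable.
\<close>
theorem twisted_equilibrium_exists:
  fixes \<theta> :: "nat \<Rightarrow> real" and q :: int and r m D :: real
  assumes mono: "\<And>i j. i \<le> j \<Longrightarrow> j < n \<Longrightarrow> \<theta> i \<le> \<theta> j"
    and range: "\<And>i. i < n \<Longrightarrow> 0 \<le> \<theta> i \<and> \<theta> i < 2 * pi"
    and adj: "\<And>i j. i < n \<Longrightarrow> j < n \<Longrightarrow> adj i j \<longleftrightarrow> i \<noteq> j \<and> near r (\<theta> i) (\<theta> j)"
    and "0 < r" "3 * r \<le> 2 * pi"
    and lower: "\<And>p. m \<le> real (card {k. k < n \<and> near (r / 2) (\<theta> k) p})" and "m > 0"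
    and upper: "\<And>i. i < n \<Longrightarrow> real (card {k. k < n \<and> near r (\<theta> k) (\<theta> i)}) \<le> D"
    and small: "\<bar>q\<bar> * r \<le> pi / 3" "16 * (real n * D * (q * r)\<^sup>2) < m * (pi / 3)\<^sup>2"
  shows "\<exists>u. asymptotically_stable_on n (kuramoto_field n r adj) (zero_sum_hyperplane n) u
    \<and> has_index n u q"
proof -
  define g where "g i j = angle_diff (\<theta> j) (\<theta> i)" for i j
  define c where "c i j = q * (g i j - (\<theta> j - \<theta> i))" for i j
  have "r \<le> pi" using \<open>3 * r \<le> 2 * pi\<close> pi_gt_zero by linarith
  have cover: "\<exists>k<n. near (r / 2) (\<theta> k) p" for p
  proof -
    have "real (card {k. k < n \<and> near (r / 2) (\<theta> k) p}) > 0" using lower[of p] \<open>m > 0\<close> by linarith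
    then have "{k. k < n \<and> near (r / 2) (\<theta> k) p} \<noteq> {}" by (metis card.empty of_nat_0 less_irrefl)
    then show ?thesis by auto
  qed
  have "n > 0" using cover[of 0] by auto
  have g_adj: "\<exists>z::int. c i j = 2 * pi * z" "\<bar>g i j\<bar> < r" if nr: "near r (\<theta> i) (\<theta> j)" for i j
  proof -
    obtain z where z: "angle_diff (\<theta> j) (\<theta> i) = \<theta> j - \<theta> i + 2 * pi * of_int z"
      "\<bar>angle_diff (\<theta> j) (\<theta> i)\<bar> < r"
      using near_angle_diff[OF near_sym[OF nr] \<open>r \<le> pi\<close>] .
    then show "\<bar>g i j\<bar> < r" by (simp add: g_def)
    have "c i j = 2 * pi * of_int (q * z)" by (simp add: c_def g_def z(1) algebra_simps)
    then show "\<exists>z::int. c i j = 2 * pi * z" by blast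
  qed
  \<comment> \<open>Away from the edges \<open>angle_diff\<close> may be unspecified (antipodal points); \<open>c'\<close> is a multiple of \<open>2 \<pi>\<close> everywhere.\<close>
  define c' where "c' i j = (if near r (\<theta> i) (\<theta> j) then c i j else 0)" for i j
  have c': "\<exists>z::int. c' i j = 2 * pi * z" for i j
    using g_adj(1)[of i j] by (auto simp: c'_def intro: exI[of _ 0])
  have g0: "g i i = 0" for i
    using angle_diff_eqI[of "\<theta> i" "\<theta> i" 0] by (simp add: g_def)
  then have c0: "c' i i = 0" for i by (simp add: c'_def c_def)
  have sym: "adj j i" if "i < n" "j < n" "adj i j" for i j
    using that adj near_sym by auto
  have gap: "\<theta> (Suc i mod n) - \<theta> i + turn n i < r" if "i < n" for i
    by (rule consecutive_gap[where r = r]) (use mono range cover that in blast)+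
  have gap0: "\<theta> (Suc i mod n) - \<theta> i + turn n i \<ge> 0" if "i < n" for i
  proof (cases "Suc i < n")
    case True
    then show ?thesis using mono[of i "Suc i"] by (simp add: turn_def)
  next
    case False
    then show ?thesis using range[of "Suc i mod n"] range[of i] that \<open>n > 0\<close> by (auto simp: turn_def)
  qed
  have turn_int: "turn n i = 2 * pi * of_int (if Suc i < n then 0 else 1)" for i by (simp add: turn_def)
  have near_next: "near r (\<theta> i) (\<theta> (Suc i mod n))" if "i < n" for i
  proof (rule near_sym, unfold near_def, rule exI)
    show "\<bar>\<theta> (Suc i mod n) - \<theta> i + 2 * pi * of_int (if Suc i < n then 0 else 1)\<bar> < r"
      using gap[OF that] gap0[OF that] unfolding turn_int by simp
  qed
  have next_neq: "Suc i mod n \<noteq> i" if "i < n" for i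
  proof
    assume eq: "Suc i mod n = i"
    then have "\<not> Suc i < n" by auto
    then have "turn n i < r" using gap[OF that] eq by simp
    then show False using \<open>\<not> Suc i < n\<close> \<open>r \<le> pi\<close> pi_gt_zero by (simp add: turn_def)
  qed
  have adj_next: "adj i (Suc i mod n)" if "i < n" for i
    using near_next[OF that] next_neq[OF that] adj[of i "Suc i mod n"] that by auto
  have path: "adj i (Suc i)" if "Suc i < n" for i
    using adj_next[of i] that by simp
  have nearI: "near r (\<theta> i) (\<theta> j)" if "i < n" "j < n" "adj i j" for i j using adj that by simp

  define a where "a = \<bar>q\<bar> * r"
  have "0 \<le> a" using \<open>0 < r\<close> by (simp add: a_def)
  have start: "(\<lambda>i. q * \<theta> i) \<in> window n adj c' a"
  proof -
    have "\<bar>q * \<theta> j - q * \<theta> i + c' i j\<bar> \<le> a" if "i < n" "j < n" "adj i j" for i j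
    proof -
      have "q * \<theta> j - q * \<theta> i + c' i j = q * g i j"
        using nearI[OF that] by (simp add: c'_def c_def algebra_simps)
      then show ?thesis
        using g_adj(2)[OF nearI[OF that]] by (simp add: a_def abs_mult mult_left_mono)
    qed
    then show ?thesis by (simp add: window_def)
  qed
  have "D \<ge> 0" using upper[OF \<open>n > 0\<close>] by linarith
  have deg: "real (card {j. j < n \<and> adj i j}) \<le> D" if "i < n" for i
  proof -
    have "card {j. j < n \<and> adj i j} \<le> card {k. k < n \<and> near r (\<theta> k) (\<theta> i)}"
      by (intro card_mono) (use that adj near_sym in auto)
    then show ?thesis using upper[OF that] by linarith
  qed
  define E where "E = real n * D * a\<^sup>2 / 2"
  have E: "energy n adj (\<lambda>i. q * \<theta> i) \<le> E"
    unfolding E_def by (rule energy_upper_bound[OF c' start deg \<open>0 \<le> a\<close>])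
  define \<rho> where "\<rho> = sqrt (32 * E / m)"
  have "E \<ge> 0" using \<open>D \<ge> 0\<close> by (simp add: E_def)
  have "\<rho> < pi / 3"
  proof -
    have "32 * E / m < (pi / 3)\<^sup>2"
      using small(2) \<open>m > 0\<close> by (simp add: E_def a_def power_mult_distrib field_simps)
    then have "\<rho> < sqrt ((pi / 3)\<^sup>2)" unfolding \<rho>_def by (rule real_sqrt_less_mono)
    then show ?thesis by simp
  qed
  have "\<rho> \<ge> 0" using \<open>E \<ge> 0\<close> \<open>m > 0\<close> by (simp add: \<rho>_def)
  \<comment> \<open>Comparison with the twisted configuration; the common neighbours are the nodes near the midpoint of the edge.\<close>
  have apriori: "u \<in> window n adj c' \<rho>"
    if u: "u \<in> window n adj c' (pi / 3)" "energy n adj u \<le> energy n adj (\<lambda>i. q * \<theta> i)" for u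
  proof -
    have "\<bar>u j - u i + c' i j\<bar> \<le> \<rho>" if ij: "i < n" "j < n" "adj i j" for i j
    proof -
      obtain p where p: "near (r / 2) p (\<theta> i)" "near (r / 2) p (\<theta> j)"
        using near_midpoint[OF nearI[OF ij]] by blast
      define N where "N = {k. k < n \<and> near (r / 2) (\<theta> k) p}"
      have Ni: "near r (\<theta> k) (\<theta> i)" and Nj: "near r (\<theta> k) (\<theta> j)" and "k < n" if "k \<in> N" for k
        using that near_trans[OF _ p(1), of "r / 2"] near_trans[OF _ p(2), of "r / 2"] by (auto simp: N_def)
      have "m * (u j - u i + c' i j)\<^sup>2 \<le> real (card N) * (u j - u i + c' i j)\<^sup>2"
        using lower[of p] by (intro mult_right_mono) (auto simp: N_def)
      also have "\<dots> \<le> 32 * energy n adj u"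
      proof (rule edge_bounded_by_energy[OF u(1) _ c' c0 ij(1,2)])
        fix k assume k: "k \<in> N"
        show "k = i \<or> adj i k" "k = j \<or> adj k j"
          using adj ij k Ni Nj near_sym \<open>k \<in> N \<Longrightarrow> k < n\<close> by auto
        have "g i j = g i k + g k j"
          using angle_diff_add[of r "\<theta> j" "\<theta> k" "\<theta> i"] Ni[OF k] Nj[OF k] nearI[OF ij] near_sym \<open>3 * r \<le> 2 * pi\<close>
          by (simp add: g_def)
        then show "c' i j = c' i k + c' k j"
          using near_sym[OF Ni[OF k]] Nj[OF k] nearI[OF ij] by (simp add: c'_def c_def algebra_simps)
      qed (auto simp: N_def)
      also have "\<dots> \<le> 32 * E" using u(2) E by simp
      finally have "(u j - u i + c' i j)\<^sup>2 \<le> 32 * E / m" using \<open>m > 0\<close> by (simp add: field_simps)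
      then show ?thesis unfolding \<rho>_def by (intro real_le_rsqrt) simp
    qed
    then show ?thesis by (simp add: window_def)
  qed
  have start': "(\<lambda>i. q * \<theta> i) \<in> window n adj c' (pi / 3)"
    using start small(1) by (fastforce simp: window_def a_def)
  obtain u where equil: "equilibrium_on n (kuramoto_field n r adj) (zero_sum_hyperplane n) u"
    and u: "u \<in> window n adj c' \<rho>"
    using interior_minimiser_is_equilibrium[OF sym path start' _ apriori \<open>\<rho> < pi / 3\<close> \<open>n > 0\<close>]
    by auto
  have "asymptotically_stable_on n (kuramoto_field n r adj) (zero_sum_hyperplane n) u"
  proof (rule acute_equilibrium_asymptotically_stable[OF sym path equil _ \<open>\<rho> \<ge> 0\<close> _ \<open>0 < r\<close> \<open>n > 0\<close>])
    show "\<rho> < pi / 2" using \<open>\<rho> < pi / 3\<close> pi_gt_zero by linarith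
    fix i j assume ij: "i < n" "j < n" "adj i j"
    obtain z :: int where z: "c' i j = 2 * pi * z" using c' by blast
    have "\<bar>u j - u i + c' i j\<bar> \<le> \<rho>" using u ij by (simp add: window_def)
    then show "\<exists>z::int. \<bar>u j - u i + 2 * pi * z\<bar> \<le> \<rho>" unfolding z by blast
  qed
  moreover have "has_index n u q"
  proof -
    \<comment> \<open>The lifted difference along a consecutive edge is less than \<open>\<pi>\<close>, hence it is the one in the index.\<close>
    have step: "angle_diff (u (Suc i mod n)) (u i)
        = u (Suc i mod n) - u i + q * (turn n i)"
      and apart: "cis (u (Suc i mod n)) \<noteq> - cis (u i)" if i: "i < n" for i
    proof -
      let ?j = "Suc i mod n"
      have "?j < n" using \<open>n > 0\<close> by simp
      have "g i ?j = \<theta> ?j - \<theta> i + turn n i"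
        unfolding g_def turn_int
        by (rule angle_diff_eqI) (use gap[OF i] gap0[OF i] \<open>r \<le> pi\<close> in \<open>simp add: turn_int\<close>)
      then have c'_eq: "c' i ?j = q * turn n i" using near_next[OF i] by (simp add: c'_def c_def)
      obtain z :: int where z: "c' i ?j = 2 * pi * z" using c' by blast
      have "\<bar>u ?j - u i + c' i ?j\<bar> \<le> \<rho>" using u i \<open>?j < n\<close> adj_next[OF i] by (simp add: window_def)
      then have acute: "\<bar>u ?j - u i + 2 * pi * z\<bar> < pi / 3" unfolding z using \<open>\<rho> < pi / 3\<close> by linarith
      then have "\<bar>u ?j - u i + 2 * pi * z\<bar> < pi" using pi_gt_zero by linarith
      then have *: "angle_diff (u ?j) (u i) = u ?j - u i + 2 * pi * z" by (rule angle_diff_eqI)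
      then show "angle_diff (u ?j) (u i) = u ?j - u i + q * (turn n i)" using c'_eq z by simp
      show "cis (u ?j) \<noteq> - cis (u i)"
      proof
        assume "cis (u ?j) = - cis (u i)"
        then have "cis (u ?j) / cis (u i) = - 1" by simp
        then have "cis (u ?j - u i) = - 1" by (simp add: cis_divide)
        then have "cos (u ?j - u i) = - 1" by (simp add: complex_eq_iff)
        moreover have "cos (u ?j - u i) = cos (u ?j - u i + 2 * pi * z)" by (simp add: cos_add[of "u ?j - u i"])
        moreover have "cos (u ?j - u i + 2 * pi * z) \<ge> 0"
          by (rule cos_ge_zero) (use acute pi_gt_zero in linarith)+
        ultimately show False by simp
      qed
    qed
    have reindex: "(\<Sum>j=1..n. f j) = (\<Sum>i<n. f (Suc i))" for f :: "nat \<Rightarrow> real"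
      by (simp add: sum.atLeast1_atMost_eq)
    have "(\<Sum>j=1..n. angle_diff (u (j mod n)) (u (j - 1)))
        = (\<Sum>i<n. u (Suc i mod n) - u i + q * turn n i)"
      unfolding reindex using step by simp
    also have "\<dots> = q * (\<Sum>i<n. turn n i)"
      by (simp add: sum.distrib sum_subtractf cyclic_sum_shift sum_distrib_left)
    also have "(\<Sum>i<n. turn n i) = 2 * pi"
    proof -
      obtain k where "n = Suc k" using \<open>n > 0\<close> gr0_implies_Suc by blast
      then show ?thesis by (simp add: turn_def)
    qed
    finally have "index n u = q" by (simp add: index_def)
    moreover have "index_defined n u"
      unfolding index_defined_def
    proof
      fix j assume "j \<in> {1..n}"
      then show "cis (u (j mod n)) \<noteq> - cis (u (j - 1))" using apart[of "j - 1"] by (cases j) auto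
    qed
    ultimately show ?thesis by (simp add: has_index_def)
  qed
  ultimately show ?thesis by blast
qed

section \<open>Ordered nodes of a configuration on the circle\<close>

lemma cis_eq_imp_congruent: "cis a = cis b \<Longrightarrow> \<exists>z::int. a = b + 2 * pi * z"
  using sin_cos_eq_iff[of a b] by (auto simp: complex_eq_iff)

lemma near_cong_cis:
  assumes "cis a = cis a'"
  shows "near r (a + c) b \<longleftrightarrow> near r (a' + c) b"
proof -
  have *: "near r (y + c) b" if "cis x = cis y" "near r (x + c) b" for x y
  proof -
    obtain z :: int where z: "x = y + 2 * pi * z" using cis_eq_imp_congruent \<open>cis x = cis y\<close> by blast
    obtain k :: int where k: "\<bar>x + c - b + 2 * pi * k\<bar> < r" using \<open>near r (x + c) b\<close> by (auto simp: near_def)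
    have "x + c - b + 2 * pi * k = y + c - b + 2 * pi * of_int (k + z)" using z by (simp add: algebra_simps)
    then have "\<bar>y + c - b + 2 * pi * of_int (k + z)\<bar> < r" using k by simp
    then show ?thesis unfolding near_def by blast
  qed
  show ?thesis using *[of a a'] *[of a' a] assms by auto
qed

lemma cis_Arg2pi: "z \<in> sphere 0 1 \<Longrightarrow> cis (Arg2pi z) = z"
  using Arg2pi_eq[of z] by (simp add: cis_conv_exp)

lemma geodesic_dist_cis_less:
  assumes "r \<le> pi"
  shows "geodesic_dist (cis a) (cis b) < r \<longleftrightarrow> near r a b"
proof
  have inner: "cis a \<bullet> cis b = cos (a - b)" by (simp add: inner_complex_def cos_diff)
  {
    assume "near r a b"
    then obtain z :: int where z: "\<bar>a - b + 2 * pi * z\<bar> < r" by (auto simp: near_def)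
    have "cos (a - b) = cos (a - b + 2 * pi * z)" by (simp add: cos_add[of "a - b"])
    then show "geodesic_dist (cis a) (cis b) < r"
      using z assms arccos_cos_eq_abs[of "a - b + 2 * pi * z"] by (simp add: geodesic_dist_def inner)
  }
  assume less: "geodesic_dist (cis a) (cis b) < r"
  define z where "z = - \<lfloor>(a - b + pi) / (2 * pi)\<rfloor>"
  have "of_int (- z) \<le> (a - b + pi) / (2 * pi)" "(a - b + pi) / (2 * pi) < of_int (- z) + 1"
    unfolding z_def by linarith+
  then have "\<bar>a - b + 2 * pi * z\<bar> \<le> pi" by (auto simp: field_simps abs_le_iff)
  moreover have "cos (a - b) = cos (a - b + 2 * pi * z)" by (simp add: cos_add[of "a - b"])
  ultimately have "\<bar>a - b + 2 * pi * z\<bar> < r"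
    using less arccos_cos_eq_abs[of "a - b + 2 * pi * z"] by (simp add: geodesic_dist_def inner)
  then show "near r a b" by (auto simp: near_def)
qed

lemma rgg_adj_cis:
  assumes "r \<le> pi" "x i \<in> sphere 0 1" "x j \<in> sphere 0 1"
  shows "rgg_adj r x i j \<longleftrightarrow> i \<noteq> j \<and> near r (Arg2pi (x i)) (Arg2pi (x j))"
  using geodesic_dist_cis_less[OF assms(1), of "Arg2pi (x i)" "Arg2pi (x j)"] assms
  by (simp add: rgg_adj_def cis_Arg2pi)

lemma ccw_nodes_sphere:
  assumes "\<And>k. k < n \<Longrightarrow> s k \<in> sphere 0 1" "i < n"
  shows "ccw_nodes n s i \<in> sphere 0 1"
proof -
  have "ccw_nodes n s i \<in> set (sort_key Arg2pi (map (\<lambda>k. s k / s 0) [0..<n]))"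
    unfolding ccw_nodes_def by (rule nth_mem) (use assms in simp)
  moreover have "0 < n" using \<open>i < n\<close> by simp
  ultimately show ?thesis using assms(1) by (auto simp: norm_divide dist_norm)
qed

lemma ccw_nodes_mono:
  assumes "i \<le> j" "j < n"
  shows "Arg2pi (ccw_nodes n s i) \<le> Arg2pi (ccw_nodes n s j)"
proof -
  let ?L = "sort_key Arg2pi (map (\<lambda>k. s k / s 0) [0..<n])"
  have "sorted (map Arg2pi ?L)" by simp
  from sorted_nth_mono[OF this \<open>i \<le> j\<close>] show ?thesis
    using assms by (simp add: ccw_nodes_def)
qed

text \<open>
  Sorting permutes the rotated sample points. All quantitative information on the nodes passes through
  such counts, which do not see the permutation.
\<close>
lemma card_ccw_nodes:
  "card {i. i < n \<and> P (ccw_nodes n s i)} = card {k. k < n \<and> P (s k / s 0)}"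
proof -
  let ?xs = "map (\<lambda>k. s k / s 0) [0..<n]"
  have "card {i. i < n \<and> P (ccw_nodes n s i)} = length (filter P (sort_key Arg2pi ?xs))"
    unfolding length_filter_conv_card by (simp add: ccw_nodes_def)
  also have "\<dots> = size (filter_mset P (mset (sort_key Arg2pi ?xs)))"
    by (simp only: mset_filter[symmetric] size_mset)
  also have "\<dots> = length (filter P ?xs)" by (simp only: mset_sort mset_filter[symmetric] size_mset)
  also have "\<dots> = card {k. k < n \<and> P (s k / s 0)}"
    unfolding length_filter_conv_card by (intro arg_cong[of _ _ card]) auto
  finally show ?thesis .
qed

lemma card_near_ccw_nodes:
  assumes "\<And>k. k < n \<Longrightarrow> s k \<in> sphere 0 1" "n > 0"
  shows "card {i. i < n \<and> near r (Arg2pi (ccw_nodes n s i)) p}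
       = card {k. k < n \<and> near r (Arg2pi (s k)) (p + Arg2pi (s 0))}"
proof -
  have "near r (Arg2pi (s k / s 0)) p \<longleftrightarrow> near r (Arg2pi (s k)) (p + Arg2pi (s 0))" if "k < n" for k
  proof -
    have "s k / s 0 \<in> sphere 0 1" using assms that by (auto simp: norm_divide)
    then have "cis (Arg2pi (s k / s 0)) = s k / s 0" by (rule cis_Arg2pi)
    also have "\<dots> = cis (Arg2pi (s k)) / cis (Arg2pi (s 0))"
      using assms that by (simp only: cis_Arg2pi)
    also have "\<dots> = cis (Arg2pi (s k) - Arg2pi (s 0))" by (rule cis_divide)
    finally have "near r (Arg2pi (s k / s 0) + 0) p \<longleftrightarrow> near r (Arg2pi (s k) - Arg2pi (s 0) + 0) p"
      by (rule near_cong_cis)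
    also have "\<dots> \<longleftrightarrow> near r (Arg2pi (s k)) (p + Arg2pi (s 0))"
      unfolding near_def by (simp add: algebra_simps)
    finally show ?thesis by simp
  qed
  then show ?thesis
    unfolding card_ccw_nodes[of n "\<lambda>z. near r (Arg2pi z) p"] by (metis (no_types, lifting) Collect_cong)
qed

section \<open>Equidistributed configurations\<close>

definition sector :: "nat \<Rightarrow> nat \<Rightarrow> complex set" where
  "sector m l = {z. 2 * pi * l / m \<le> Arg2pi z \<and> Arg2pi z < 2 * pi * (l + 1) / m}"

definition equidistributed :: "nat \<Rightarrow> nat \<Rightarrow> (nat \<Rightarrow> complex) \<Rightarrow> bool" where
  "equidistributed m n s \<longleftrightarrow> (\<forall>l<m.
     real n / (4 * real m) \<le> card {k. k < n \<and> s k \<in> sector m l} \<and>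
     card {k. k < n \<and> s k \<in> sector m l} \<le> 3 * real n / real m)"

text \<open>
  For an arbitrary angle this is the number of its sector in the periodic continuation of the partition to the
  real line; it is kept an integer to allow angles outside of \<open>[0, 2 \<pi>)\<close>.
\<close>
definition sector_index :: "nat \<Rightarrow> real \<Rightarrow> int" where
  "sector_index m t = \<lfloor>t * m / (2 * pi)\<rfloor>"

lemma sector_index_range:
  assumes "0 \<le> t" "t < 2 * pi" "m > 0"
  shows "0 \<le> sector_index m t" "sector_index m t < int m"
proof -
  show "0 \<le> sector_index m t" using assms by (simp add: sector_index_def)
  have "t * m / (2 * pi) < m" using assms by (simp add: field_simps)
  then show "sector_index m t < int m" by (simp add: sector_index_def floor_less_iff)
qed

lemma sector_index_bounds:
  assumes "m > 0"
  shows "2 * pi * sector_index m t / m \<le> t" "t < 2 * pi * (sector_index m t + 1) / m"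
proof -
  have "sector_index m t \<le> t * m / (2 * pi)" "t * m / (2 * pi) < sector_index m t + 1"
    by (simp_all add: sector_index_def)
  then show "2 * pi * sector_index m t / m \<le> t" "t < 2 * pi * (sector_index m t + 1) / m"
    using assms by (simp_all add: field_simps)
qed

lemma in_sector_iff:
  assumes "m > 0"
  shows "z \<in> sector m l \<longleftrightarrow> sector_index m (Arg2pi z) = int l"
proof -
  have "sector_index m (Arg2pi z) = int l \<longleftrightarrow>
      real l \<le> Arg2pi z * m / (2 * pi) \<and> Arg2pi z * m / (2 * pi) < real l + 1"
    by (simp add: sector_index_def floor_eq_iff)
  also have "\<dots> \<longleftrightarrow> z \<in> sector m l" using assms by (simp add: sector_def field_simps)
  finally show ?thesis by simp
qed

lemma reduce_angle: "\<exists>z::int. 0 \<le> p + 2 * pi * z \<and> p + 2 * pi * z < 2 * pi" for p :: real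
proof -
  define z where "z = - \<lfloor>p / (2 * pi)\<rfloor>"
  have "of_int (- z) \<le> p / (2 * pi)" "p / (2 * pi) < of_int (- z) + 1"
    unfolding z_def by linarith+
  then show ?thesis by (intro exI[of _ z]) (auto simp: field_simps)
qed

lemma near_shift: "near r a (b + 2 * pi * of_int z) \<longleftrightarrow> near r a b"
proof -
  have *: "near r a (c + 2 * pi * of_int y)" if nr: "near r a c" for c and y :: int
  proof -
    obtain k :: int where "\<bar>a - c + 2 * pi * k\<bar> < r" using nr by (auto simp: near_def)
    then have "\<bar>a - (c + 2 * pi * y) + 2 * pi * of_int (k + y)\<bar> < r" by (simp add: algebra_simps)
    then show ?thesis unfolding near_def by blast
  qed
  show ?thesis using *[of b z] *[of "b + 2 * pi * of_int z" "- z"] by auto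
qed

text \<open>
  Sectors are narrower than \<open>r / 2\<close>, so the one containing \<open>p\<close> lies in the ball around \<open>p\<close>.
\<close>
lemma equidistributed_lower:
  assumes "equidistributed m n s" and m: "4 * pi < m * r"
  shows "real n / (4 * real m) \<le> card {k. k < n \<and> near (r / 2) (Arg2pi (s k)) p}"
proof -
  have "m > 0" using m pi_gt_zero by (intro gr0I) auto
  obtain z :: int where z: "0 \<le> p + 2 * pi * z" "p + 2 * pi * z < 2 * pi" using reduce_angle by blast
  define p' where "p' = p + 2 * pi * z"
  define l where "l = nat (sector_index m p')"
  have l: "sector_index m p' = int l" "l < m"
    using sector_index_range[of p' m] z \<open>m > 0\<close> by (auto simp: l_def p'_def)
  have "near (r / 2) (Arg2pi w) p" if w: "w \<in> sector m l" for w
  proof -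
    have *: "sector_index m (Arg2pi w) = int l" using w in_sector_iff \<open>m > 0\<close> by simp
    define A B where "A = 2 * pi * int l / m" and "B = 2 * pi * (int l + 1) / m"
    have "B - A < r / 2"
      using m \<open>m > 0\<close> unfolding A_def B_def diff_divide_distrib[symmetric] by (simp add: field_simps)
    moreover have "A \<le> Arg2pi w" "Arg2pi w < B" "A \<le> p'" "p' < B"
      using sector_index_bounds[OF \<open>m > 0\<close>, of "Arg2pi w"] sector_index_bounds[OF \<open>m > 0\<close>, of p']
      unfolding * l(1) by (simp_all add: A_def B_def)
    ultimately have "\<bar>Arg2pi w - p'\<bar> < r / 2" by (simp only: abs_less_iff) linarith
    then have "\<bar>Arg2pi w - p' + 2 * pi * of_int 0\<bar> < r / 2" by simp
    then have "near (r / 2) (Arg2pi w) p'" unfolding near_def by blast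
    then show ?thesis by (simp add: p'_def near_shift)
  qed
  then have "card {k. k < n \<and> s k \<in> sector m l} \<le> card {k. k < n \<and> near (r / 2) (Arg2pi (s k)) p}"
    by (intro card_mono) auto
  moreover have "real n / (4 * real m) \<le> card {k. k < n \<and> s k \<in> sector m l}"
    using assms(1) l(2) by (simp add: equidistributed_def)
  ultimately show ?thesis by linarith
qed

text \<open>
  On the line, an interval of radius \<open>r\<close> meets at most \<open>7\<close> sectors. Arguments in \<open>[0, 2 \<pi>)\<close> only come close to the
  translates of \<open>p\<close> by \<open>-1\<close>, \<open>0\<close> and \<open>1\<close> turns, so \<open>21\<close> sectors, each with at most \<open>3 n / m\<close> points,
  cover the ball. The crude count avoids arithmetic modulo \<open>m\<close>.
\<close>
lemma equidistributed_upper: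
  assumes "equidistributed m n s" and m: "m * r \<le> 5 * pi" "m > 0" and "r \<le> pi"
  shows "card {k. k < n \<and> near r (Arg2pi (s k)) p} \<le> 63 * real n / real m"
proof -
  obtain z :: int where z: "0 \<le> p + 2 * pi * z" "p + 2 * pi * z < 2 * pi" using reduce_angle by blast
  define p' where "p' = p + 2 * pi * z"
  define y where "y j = sector_index m (p' - 2 * pi * of_int j)" for j
  define T where "T = (\<Union>j\<in>{-1..1}. {y j - 3..y j + 3}) \<inter> {0..<int m}"
  have fin: "finite T" by (simp add: T_def)
  have cardT: "card T \<le> 21"
  proof -
    have "card T \<le> card (\<Union>j\<in>{-1..1::int}. {y j - 3..y j + 3})"
      unfolding T_def by (intro card_mono) auto
    also have "\<dots> \<le> (\<Sum>j\<in>{-1..1::int}. card {y j - 3..y j + 3})" by (rule card_UN_le) simp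
    also have "\<dots> = 21" by simp
    finally show ?thesis .
  qed
  have index: "sector_index m (Arg2pi w) \<in> T" if w: "near r (Arg2pi w) p" for w
  proof -
    have range: "0 \<le> Arg2pi w" "Arg2pi w < 2 * pi" using Arg2pi[of w] by auto
    have "near r (Arg2pi w) p'" using w by (simp add: p'_def near_shift)
    then obtain j :: int where j: "\<bar>Arg2pi w - p' + 2 * pi * j\<bar> < r" by (auto simp: near_def)
    have "\<bar>2 * pi * j\<bar> < 2 * pi * 2"
      using j range z \<open>r \<le> pi\<close> unfolding p'_def by linarith
    then have "2 * pi * \<bar>of_int j\<bar> < 2 * pi * (2::real)" by (simp add: abs_mult)
    then have "\<bar>of_int j\<bar> < (2::real)" using mult_less_cancel_left_pos[of "2 * pi"] by simp
    then have "j \<in> {-1..1}" by auto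
    define u v where "u = Arg2pi w * m / (2 * pi)" and "v = (p' - 2 * pi * of_int j) * m / (2 * pi)"
    have "\<bar>u - v\<bar> = \<bar>Arg2pi w - p' + 2 * pi * j\<bar> * m / (2 * pi)"
      by (simp add: u_def v_def abs_mult flip: diff_divide_distrib left_diff_distrib)
         (simp add: algebra_simps)
    also have "\<dots> \<le> r * m / (2 * pi)" using j by (intro divide_right_mono mult_right_mono) auto
    also have "\<dots> \<le> 5 * pi / (2 * pi)"
      using m(1) by (intro divide_right_mono) (simp_all add: mult.commute)
    also have "\<dots> < 3" by simp
    finally have "\<bar>u - v\<bar> < 3" .
    then have "\<lfloor>u\<rfloor> \<in> {\<lfloor>v\<rfloor> - 3..\<lfloor>v\<rfloor> + 3}" by (simp, linarith)
    then have "sector_index m (Arg2pi w) \<in> {y j - 3..y j + 3}" by (simp add: sector_index_def y_def u_def v_def)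
    then show ?thesis
      using \<open>j \<in> {-1..1}\<close> sector_index_range[OF range \<open>m > 0\<close>] unfolding T_def by auto
  qed
  have "{k. k < n \<and> near r (Arg2pi (s k)) p} \<subseteq> (\<Union>l\<in>T. {k. k < n \<and> s k \<in> sector m (nat l)})"
  proof
    fix k assume k: "k \<in> {k. k < n \<and> near r (Arg2pi (s k)) p}"
    then have T: "sector_index m (Arg2pi (s k)) \<in> T" using index by simp
    then have "s k \<in> sector m (nat (sector_index m (Arg2pi (s k))))"
      using in_sector_iff[OF \<open>m > 0\<close>] by (simp add: T_def)
    then show "k \<in> (\<Union>l\<in>T. {k. k < n \<and> s k \<in> sector m (nat l)})" using T k by blast
  qed
  then have "card {k. k < n \<and> near r (Arg2pi (s k)) p} \<le> card (\<Union>l\<in>T. {k. k < n \<and> s k \<in> sector m (nat l)})"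
    by (intro card_mono) (use fin in auto)
  also have "\<dots> \<le> (\<Sum>l\<in>T. card {k. k < n \<and> s k \<in> sector m (nat l)})" by (rule card_UN_le[OF fin])
  finally have "real (card {k. k < n \<and> near r (Arg2pi (s k)) p})
      \<le> (\<Sum>l\<in>T. real (card {k. k < n \<and> s k \<in> sector m (nat l)}))"
    unfolding of_nat_sum[symmetric] of_nat_le_iff .
  also have "\<dots> \<le> (\<Sum>l\<in>T. 3 * real n / real m)"
    using assms(1) by (intro sum_mono) (auto simp: equidistributed_def T_def)
  also have "\<dots> = card T * (3 * real n / real m)" by simp
  also have "\<dots> \<le> 21 * (3 * real n / real m)" using cardT by (intro mult_right_mono) auto
  finally show ?thesis by simp
qed

text \<open>
  Equidistribution makes the ratio of maximal degree and number of common neighbours at most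
  \<open>63 \<cdot> 4 = 252\<close>; with the factor \<open>16\<close> of the deterministic bound this gives \<open>4032\<close>.
\<close>
theorem equidistributed_twisted_equilibrium:
  fixes q :: int and r :: real
  assumes s: "\<And>k. k < n \<Longrightarrow> s k \<in> sphere 0 1" and "n > 0"
    and "0 < r" and small: "4032 * (real n * r\<^sup>2 * (q\<^sup>2 + 1)) \<le> 1"
    and m: "4 * pi < m * r" "m * r \<le> 5 * pi"
    and equi: "equidistributed m n s"
  shows "\<exists>u. asymptotically_stable_on n (kuramoto_field n r (rgg_adj r (ccw_nodes n s)))
      (zero_sum_hyperplane n) u \<and> has_index n u q"
proof -
  have "m > 0" using m(1) pi_gt_zero by (intro gr0I) auto
  have "r\<^sup>2 * (q\<^sup>2 + 1) \<le> real n * (r\<^sup>2 * (q\<^sup>2 + 1))"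
    using \<open>n > 0\<close> mult_right_mono[of 1 "real n" "r\<^sup>2 * (q\<^sup>2 + 1)"] by simp
  then have "r\<^sup>2 * (q\<^sup>2 + 1) \<le> 1" using small by (simp add: mult.assoc)
  then have le1: "r\<^sup>2 + (q * r)\<^sup>2 \<le> 1" by (simp add: power_mult_distrib algebra_simps)
  have "r\<^sup>2 \<le> 1\<^sup>2" "(q * r)\<^sup>2 \<le> 1\<^sup>2"
    using le1 zero_le_power2[of r] zero_le_power2[of "q * r"] unfolding one_power2 by linarith+
  then have r1: "r \<le> 1" and qr1: "\<bar>q\<bar> * r \<le> 1"
    using \<open>0 < r\<close> unfolding abs_le_square_iff[symmetric] by (simp_all add: abs_mult)
  have "r \<le> pi" using r1 pi_gt3 by linarith
  define \<theta> where "\<theta> i = Arg2pi (ccw_nodes n s i)" for i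
  have card: "card {k. k < n \<and> near a (\<theta> k) p} = card {k. k < n \<and> near a (Arg2pi (s k)) (p + Arg2pi (s 0))}" for a p
    unfolding \<theta>_def using card_near_ccw_nodes s \<open>n > 0\<close> by blast
  show ?thesis
  proof (rule twisted_equilibrium_exists[where \<theta> = \<theta> and m = "real n / (4 * real m)" and D = "63 * real n / real m"])
    show "\<theta> i \<le> \<theta> j" if "i \<le> j" "j < n" for i j
      using ccw_nodes_mono[OF that] by (simp add: \<theta>_def)
    show "0 \<le> \<theta> i \<and> \<theta> i < 2 * pi" for i using Arg2pi by (simp add: \<theta>_def)
    show "rgg_adj r (ccw_nodes n s) i j \<longleftrightarrow> i \<noteq> j \<and> near r (\<theta> i) (\<theta> j)" if "i < n" "j < n" for i j
      unfolding \<theta>_def by (rule rgg_adj_cis[OF \<open>r \<le> pi\<close>]) (use ccw_nodes_sphere s that in blast)+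
    show "3 * r \<le> 2 * pi" using r1 pi_gt3 by linarith
    show "real n / (4 * real m) \<le> card {k. k < n \<and> near (r / 2) (\<theta> k) p}" for p
      unfolding card using equidistributed_lower[OF equi m(1)] by blast
    show "0 < real n / (4 * real m)" using \<open>n > 0\<close> \<open>m > 0\<close> by simp
    show "card {k. k < n \<and> near r (\<theta> k) (\<theta> i)} \<le> 63 * real n / real m" for i
      unfolding card using equidistributed_upper[OF equi m(2) \<open>m > 0\<close> \<open>r \<le> pi\<close>] by blast
    show "\<bar>q\<bar> * r \<le> pi / 3" using qr1 pi_gt3 by simp
    have "4032 * (real n * (q * r)\<^sup>2) \<le> 4032 * (real n * r\<^sup>2 * (q\<^sup>2 + 1))"
      using \<open>n > 0\<close> by (simp add: power_mult_distrib algebra_simps)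
    also have "\<dots> \<le> 1\<^sup>2" using small by simp
    also have "1\<^sup>2 < (pi / 3)\<^sup>2" by (rule power_strict_mono) (use pi_gt3 in auto)
    finally have "real n / (4 * real m) * (4032 * (real n * (q * r)\<^sup>2)) < real n / (4 * real m) * (pi / 3)\<^sup>2"
      using \<open>n > 0\<close> \<open>m > 0\<close> by (intro mult_strict_left_mono) auto
    then show "16 * (real n * (63 * real n / real m) * (q * r)\<^sup>2) < real n / (4 * real m) * (pi / 3)\<^sup>2"
      by (simp add: field_simps)
  qed (fact \<open>0 < r\<close>)
qed

section \<open>Concentration of a uniform sample\<close>

text \<open>
  The exponential of the count is a product of independent factors \<open>1 + (exp h - 1) 1\<^sub>A(X\<^sub>i)\<close>.
\<close>
lemma (in prob_space) exponential_moment_of_count: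
  fixes X :: "nat \<Rightarrow> 'a \<Rightarrow> 'b" and p h :: real
  assumes indep: "indep_vars (\<lambda>_. N) X {..<n}" and A: "A \<in> sets N"
    and p: "\<And>i. i < n \<Longrightarrow> prob {\<omega> \<in> space M. X i \<omega> \<in> A} = p"
  shows "integrable M (\<lambda>\<omega>. exp (h * card {i. i < n \<and> X i \<omega> \<in> A}))"
    and "expectation (\<lambda>\<omega>. exp (h * card {i. i < n \<and> X i \<omega> \<in> A})) = (1 + p * (exp h - 1)) ^ n"
proof -
  define Y where "Y i \<omega> = exp (h * indicator A (X i \<omega>))" for i \<omega>
  have rv [measurable]: "X i \<in> measurable M N" if "i < n" for i
    using indep that by (auto simp: indep_vars_def)
  have Y_indep: "indep_vars (\<lambda>_. borel) Y {..<n}"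
    unfolding Y_def by (rule indep_vars_compose2[OF indep]) (use A in measurable)
  have ev: "{\<omega> \<in> space M. X i \<omega> \<in> A} \<in> events" if "i < n" for i
    using measurable_sets[OF rv[OF that] A] by (simp add: vimage_def Int_def conj_commute)
  have Y_eq: "Y i \<omega> = 1 + (exp h - 1) * indicator {\<omega> \<in> space M. X i \<omega> \<in> A} \<omega>"
    if "\<omega> \<in> space M" for i \<omega> using that by (simp add: Y_def indicator_def)
  have int: "integrable M (Y i)" and exp: "expectation (Y i) = 1 + p * (exp h - 1)" if "i < n" for i
  proof -
    let ?f = "\<lambda>\<omega>. 1 + (exp h - 1) * indicat_real {\<omega> \<in> space M. X i \<omega> \<in> A} \<omega>"
    have ind: "integrable M (indicat_real {\<omega> \<in> space M. X i \<omega> \<in> A})"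
      using ev[OF that] by (simp add: emeasure_eq_measure)
    then have "integrable M ?f" by simp
    moreover have "integrable M (Y i) \<longleftrightarrow> integrable M ?f"
      by (rule Bochner_Integration.integrable_cong) (simp_all add: Y_eq)
    ultimately show "integrable M (Y i)" by simp
    have "expectation (Y i) = expectation ?f"
      by (rule Bochner_Integration.integral_cong) (simp_all add: Y_eq)
    also have "\<dots> = 1 + (exp h - 1) * prob {\<omega> \<in> space M. X i \<omega> \<in> A}"
      using ind ev[OF that] by (simp add: prob_space)
    finally show "expectation (Y i) = 1 + p * (exp h - 1)" using p[OF that] by simp
  qed
  have prod: "(\<Prod>i<n. Y i \<omega>) = exp (h * card {i. i < n \<and> X i \<omega> \<in> A})" for \<omega>
  proof -
    have "(\<Prod>i<n. Y i \<omega>) = exp (h * (\<Sum>i<n. indicator A (X i \<omega>)))"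
      by (simp only: Y_def exp_sum sum_distrib_left finite_lessThan)
    also have "(\<Sum>i<n. indicat_real A (X i \<omega>)) = card {i. i < n \<and> X i \<omega> \<in> A}"
      using sum.inter_filter[of "{..<n}" "\<lambda>_. 1::real" "\<lambda>i. X i \<omega> \<in> A"]
      by (simp add: indicator_def of_bool_def)
    finally show ?thesis .
  qed
  show "integrable M (\<lambda>\<omega>. exp (h * card {i. i < n \<and> X i \<omega> \<in> A}))"
    using indep_vars_integrable[OF _ Y_indep] int by (simp add: prod)
  show "expectation (\<lambda>\<omega>. exp (h * card {i. i < n \<and> X i \<omega> \<in> A})) = (1 + p * (exp h - 1)) ^ n"
    using indep_vars_lebesgue_integral[OF _ Y_indep] int exp by (simp add: prod)
qed

text \<open>
  A positive \<open>h\<close> gives the upper tail and a negative \<open>h\<close> the lower tail.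
\<close>
lemma (in prob_space) chernoff_count:
  fixes X :: "nat \<Rightarrow> 'a \<Rightarrow> 'b" and p h t :: real
  assumes indep: "indep_vars (\<lambda>_. N) X {..<n}" and A: "A \<in> sets N"
    and p: "\<And>i. i < n \<Longrightarrow> prob {\<omega> \<in> space M. X i \<omega> \<in> A} = p" "0 \<le> p" "p \<le> 1"
  shows "prob {\<omega> \<in> space M. t \<le> h * card {i. i < n \<and> X i \<omega> \<in> A}} \<le> exp (n * p * (exp h - 1) - t)"
proof -
  have "prob {\<omega> \<in> space M. t \<le> h * card {i. i < n \<and> X i \<omega> \<in> A}}
      = prob {\<omega> \<in> space M. exp t \<le> exp (h * card {i. i < n \<and> X i \<omega> \<in> A})}" by simp
  also have "\<dots> \<le> expectation (\<lambda>\<omega>. exp (h * card {i. i < n \<and> X i \<omega> \<in> A})) / exp t"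
    by (rule integral_Markov_inequality_measure[where A = "{}"])
       (use exponential_moment_of_count(1)[OF indep A p(1)] in auto)
  also have "\<dots> = (1 + p * (exp h - 1)) ^ n / exp t"
    using exponential_moment_of_count(2)[OF indep A p(1)] by simp
  also have "\<dots> \<le> exp (p * (exp h - 1)) ^ n / exp t"
  proof (intro divide_right_mono power_mono)
    have "0 \<le> (1 - p) + p * exp h" using p by simp
    then show "0 \<le> 1 + p * (exp h - 1)" by (simp add: algebra_simps)
  qed (simp_all add: exp_ge_add_one_self)
  also have "\<dots> = exp (n * p * (exp h - 1) - t)"
    by (simp add: exp_diff exp_of_nat_mult[symmetric] mult.assoc)
  finally show ?thesis .
qed

lemma borel_measurable_Arg2pi [measurable]: "Arg2pi \<in> borel_measurable borel"
  by (rule borel_measurableI_greater) (simp add: open_Arg2pi2pi_gt)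

lemma sector_borel [measurable]: "sector m l \<in> sets borel"
  unfolding sector_def by measurable

lemma measure_circle_uniform_sector:
  assumes "l < m"
  shows "measure circle_uniform (sector m l) = 1 / m"
proof -
  define a b where "a = 2 * pi * l / m" and "b = 2 * pi * (l + 1) / m"
  have ab: "0 \<le> a" "a \<le> b" "b \<le> 2 * pi" "b - a = 2 * pi / m"
  proof -
    have "2 * pi * (l + 1) \<le> 2 * pi * m" using assms by (intro mult_left_mono) auto
    then show "b \<le> 2 * pi" using assms by (simp add: b_def divide_le_eq)
    show "b - a = 2 * pi / m" by (simp add: a_def b_def algebra_simps flip: diff_divide_distrib)
    show "0 \<le> a" "a \<le> b" by (auto simp: a_def b_def intro!: divide_right_mono)
  qed
  have [measurable]: "cis \<in> borel_measurable borel"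
    by (intro borel_measurable_continuous_onI continuous_intros)
  have arg: "Arg2pi (cis t) = t" if "t \<in> {0..<2 * pi}" for t
    using Arg2pi_exp[of "\<i> * complex_of_real t"] that by (simp add: cis_conv_exp)
  have "sector m l = {z. a \<le> Arg2pi z \<and> Arg2pi z < b}" by (simp add: sector_def a_def b_def)
  then have eq: "{0..<2 * pi} \<inter> cis -` sector m l = {a..<b}"
    using ab arg by auto
  have "measure circle_uniform (sector m l)
      = measure (uniform_measure lborel {0..<2 * pi}) (cis -` sector m l \<inter> space (uniform_measure lborel {0..<2 * pi}))"
    unfolding circle_uniform_def by (intro measure_distr) auto
  also have "\<dots> = measure (uniform_measure lborel {0..<2 * pi}) (cis -` sector m l)" by simp
  also have "\<dots> = measure lborel ({0..<2 * pi} \<inter> cis -` sector m l) / measure lborel {0..<2 * pi}"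
    using measurable_sets[of cis borel borel "sector m l"] by (intro measure_uniform_measure) simp_all
  also have "\<dots> = 1 / m" using ab(2,4) unfolding eq by simp
  finally show ?thesis .
qed

text \<open>
  Chernoff's bound with \<open>h = -1\<close> and \<open>h = 1\<close> for each of the \<open>m\<close> sectors, where the counts have mean \<open>n / m\<close>.
\<close>
lemma uniform_sample_equidistributed:
  assumes sample: "uniform_circle_sample M n X" and "m > 0"
  shows "{\<omega> \<in> space M. equidistributed m n (\<lambda>k. X k \<omega>)} \<in> sets M"
    and "1 - 2 * real m * exp (- (n / (4 * real m))) \<le> measure M {\<omega> \<in> space M. equidistributed m n (\<lambda>k. X k \<omega>)}"
proof -
  interpret prob_space M using sample by (simp add: uniform_circle_sample_def)
  have indep: "indep_vars (\<lambda>_. borel) X {..<n}" using sample by (simp add: uniform_circle_sample_def)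
  have rv [measurable]: "X i \<in> borel_measurable M" if "i < n" for i
    using indep that by (auto simp: indep_vars_def)
  define C where "C l \<omega> = real (card {k. k < n \<and> X k \<omega> \<in> sector m l})" for l \<omega>
  have C_eq: "C l \<omega> = (\<Sum>k<n. indicator (sector m l) (X k \<omega>))" for l \<omega>
    using sum.inter_filter[of "{..<n}" "\<lambda>_. 1::real" "\<lambda>k. X k \<omega> \<in> sector m l"]
    by (simp add: C_def indicator_def of_bool_def)
  have [measurable]: "C l \<in> borel_measurable M" for l
    unfolding C_eq[abs_def] by measurable
  have prob: "prob {\<omega> \<in> space M. X i \<omega> \<in> sector m l} = 1 / m" if "i < n" "l < m" for i l
  proof -
    have "measure circle_uniform (sector m l) = prob (X i -` sector m l \<inter> space M)"
      using sample \<open>i < n\<close> measure_distr[OF rv[OF \<open>i < n\<close>], of "sector m l"]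
      by (simp add: uniform_circle_sample_def)
    then show ?thesis
      using measure_circle_uniform_sector[OF \<open>l < m\<close>] by (simp add: vimage_def Int_def conj_commute)
  qed
  \<comment> \<open>The weak inequalities here cover the complement of the event.\<close>
  define low high where "low l = {\<omega> \<in> space M. - (n / (4 * real m)) \<le> - 1 * C l \<omega>}"
    and "high l = {\<omega> \<in> space M. 3 * real n / real m \<le> 1 * C l \<omega>}" for l
  have sets: "low l \<in> events" "high l \<in> events" for l unfolding low_def high_def by measurable
  have m1: "1 / real m \<le> 1" using \<open>m > 0\<close> by simp
  define x where "x = real n / real m"
  have x4: "real n / (4 * real m) = x / 4" by (simp add: x_def)
  have low: "prob (low l) \<le> exp (- (n / (4 * real m)))" if "l < m" for l
  proof -
    have "prob (low l) \<le> exp (n * (1 / m) * (exp (- 1) - 1) - - (n / (4 * real m)))"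
      unfolding low_def C_def by (rule chernoff_count[OF indep]) (use prob that m1 in auto)
    also have "\<dots> \<le> exp (- (n / (4 * real m)))"
    proof -
      have "exp (- 1) \<le> (1 / 2 :: real)"
        using exp_ge_add_one_self[of 1] by (simp add: exp_minus field_simps)
      then have "x * exp (- 1) \<le> x * (1 / 2)" by (intro mult_left_mono) (auto simp: x_def)
      moreover have eq: "real n * (1 / real m) * (exp (- 1) - 1) = x * exp (- 1) - x"
        by (simp add: x_def algebra_simps diff_divide_distrib)
      ultimately show ?thesis unfolding x4 eq by simp
    qed
    finally show ?thesis .
  qed
  have high: "prob (high l) \<le> exp (- (n / (4 * real m)))" if "l < m" for l
  proof -
    have "prob (high l) \<le> exp (n * (1 / m) * (exp 1 - 1) - 3 * real n / real m)"
      unfolding high_def C_def by (rule chernoff_count[OF indep]) (use prob that m1 in auto)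
    also have "\<dots> \<le> exp (- (n / (4 * real m)))"
    proof -
      have "x * exp 1 \<le> x * 3" using exp_le by (intro mult_left_mono) (auto simp: x_def)
      moreover have eq: "real n * (1 / real m) * (exp 1 - 1) = x * exp 1 - x" "3 * real n / real m = 3 * x"
        by (simp_all add: x_def algebra_simps diff_divide_distrib)
      moreover have "x \<ge> 0" by (simp add: x_def)
      ultimately show ?thesis unfolding x4 eq by simp
    qed
    finally show ?thesis .
  qed
  have E_eq: "{\<omega> \<in> space M. equidistributed m n (\<lambda>k. X k \<omega>)}
      = {\<omega> \<in> space M. \<forall>l<m. n / (4 * real m) \<le> C l \<omega> \<and> C l \<omega> \<le> 3 * real n / real m}"
    by (simp add: equidistributed_def C_def)
  show E: "{\<omega> \<in> space M. equidistributed m n (\<lambda>k. X k \<omega>)} \<in> sets M"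
    unfolding E_eq by measurable
  have "space M - {\<omega> \<in> space M. equidistributed m n (\<lambda>k. X k \<omega>)} \<subseteq> (\<Union>l<m. low l \<union> high l)"
    unfolding E_eq low_def high_def by (auto simp: not_le intro: less_imp_le)
  then have "prob (space M - {\<omega> \<in> space M. equidistributed m n (\<lambda>k. X k \<omega>)}) \<le> prob (\<Union>l<m. low l \<union> high l)"
    by (intro finite_measure_mono) (use sets in auto)
  also have "\<dots> \<le> (\<Sum>l<m. prob (low l \<union> high l))"
    by (intro finite_measure_subadditive_finite) (use sets in auto)
  also have "\<dots> \<le> (\<Sum>l<m. 2 * exp (- (n / (4 * real m))))"
  proof (intro sum_mono)
    fix l assume "l \<in> {..<m}"
    have "prob (low l \<union> high l) \<le> prob (low l) + prob (high l)" using sets by (intro measure_Un_le)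
    then show "prob (low l \<union> high l) \<le> 2 * exp (- (n / (4 * real m)))"
      using low[of l] high[of l] \<open>l \<in> {..<m}\<close> by simp
  qed
  also have "\<dots> = 2 * real m * exp (- (n / (4 * real m)))" by simp
  finally show "1 - 2 * real m * exp (- (n / (4 * real m))) \<le> measure M {\<omega> \<in> space M. equidistributed m n (\<lambda>k. X k \<omega>)}"
    using prob_compl[OF E] by linarith
qed

section \<open>Measurability of events determined by the graph\<close>

lemma asymptotically_stable_on_cong:
  assumes "\<And>u i. i < n \<Longrightarrow> F u i = G u i"
  shows "asymptotically_stable_on n F S u \<longleftrightarrow> asymptotically_stable_on n G S u"
proof -
  have "solution_on n F S = solution_on n G S"
    by (rule ext) (auto simp: solution_on_def assms)
  then show ?thesis
    by (simp add: asymptotically_stable_on_def equilibrium_on_def lyapunov_stable_on_def attractive_on_def assms)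
qed

text \<open>
  A property of a relation on finitely many nodes depends on finitely many bits. This makes every
  graph property measurable, whatever existential quantifiers over phases or solutions it involves.
\<close>
lemma measurable_finite_relation_event:
  fixes R :: "'a \<Rightarrow> nat \<Rightarrow> nat \<Rightarrow> bool"
  assumes R: "\<And>i j. i < n \<Longrightarrow> j < n \<Longrightarrow> {\<omega> \<in> space M. R \<omega> i j} \<in> sets M"
    and local: "\<And>A B. (\<And>i j. i < n \<Longrightarrow> j < n \<Longrightarrow> A i j \<longleftrightarrow> B i j) \<Longrightarrow> Q A \<longleftrightarrow> Q B"
  shows "{\<omega> \<in> space M. Q (R \<omega>)} \<in> sets M"
proof -
  define G where "G \<omega> = {(i, j). i < n \<and> j < n \<and> R \<omega> i j}" for \<omega>
  define P where "P = {E. E \<subseteq> {..<n} \<times> {..<n} \<and> Q (\<lambda>i j. (i, j) \<in> E)}"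
  have "finite P" unfolding P_def by (rule finite_subset[of _ "Pow ({..<n} \<times> {..<n})"]) auto
  have "Q (R \<omega>) \<longleftrightarrow> G \<omega> \<in> P" for \<omega>
  proof -
    have "Q (R \<omega>) \<longleftrightarrow> Q (\<lambda>i j. (i, j) \<in> G \<omega>)" by (rule local) (simp add: G_def)
    moreover have "G \<omega> \<subseteq> {..<n} \<times> {..<n}" by (auto simp: G_def)
    ultimately show ?thesis by (simp add: P_def)
  qed
  then have "{\<omega> \<in> space M. Q (R \<omega>)} = (\<Union>E\<in>P. {\<omega> \<in> space M. G \<omega> = E})" by auto
  also have "\<dots> = (\<Union>E\<in>P. {\<omega> \<in> space M. \<forall>i\<in>{..<n}. \<forall>j\<in>{..<n}. R \<omega> i j \<longleftrightarrow> (i, j) \<in> E})"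
  proof (intro SUP_cong refl Collect_cong conj_cong)
    fix E \<omega> assume "E \<in> P"
    then show "G \<omega> = E \<longleftrightarrow> (\<forall>i\<in>{..<n}. \<forall>j\<in>{..<n}. R \<omega> i j \<longleftrightarrow> (i, j) \<in> E)"
      by (auto simp: P_def G_def)
  qed
  also have "\<dots> \<in> sets M"
  proof (intro sets.finite_UN \<open>finite P\<close>)
    fix E
    show "{\<omega> \<in> space M. \<forall>i\<in>{..<n}. \<forall>j\<in>{..<n}. R \<omega> i j \<longleftrightarrow> (i, j) \<in> E} \<in> sets M"
    proof (intro sets.sets_Collect_finite_All)
      fix i j assume "i \<in> {..<n}" "j \<in> {..<n}"
      then show "{\<omega> \<in> space M. R \<omega> i j \<longleftrightarrow> (i, j) \<in> E} \<in> sets M"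
        using R[of i j] sets.sets_Collect_neg[of M "\<lambda>\<omega>. R \<omega> i j"]
        by (cases "(i, j) \<in> E") simp_all
    qed auto
  qed
  finally show ?thesis .
qed

lemma nth_sorted_le_iff_card:
  assumes "\<And>i j. i \<le> j \<Longrightarrow> j < n \<Longrightarrow> f i \<le> (f j :: real)" "i < n"
  shows "f i \<le> t \<longleftrightarrow> i < card {k. k < n \<and> f k \<le> t}"
proof
  assume "f i \<le> t"
  have "k < n \<and> f k \<le> t" if "k \<le> i" for k
    using assms(1)[OF that assms(2)] assms(2) that \<open>f i \<le> t\<close> by simp
  then have "{..i} \<subseteq> {k. k < n \<and> f k \<le> t}" by auto
  then have "card {..i} \<le> card {k. k < n \<and> f k \<le> t}" by (intro card_mono) auto
  then show "i < card {k. k < n \<and> f k \<le> t}" by simp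
next
  assume less: "i < card {k. k < n \<and> f k \<le> t}"
  show "f i \<le> t"
  proof (rule ccontr)
    assume "\<not> f i \<le> t"
    have "k < i" if "k < n" "f k \<le> t" for k
    proof (rule ccontr)
      assume "\<not> k < i"
      then have "f i \<le> f k" using assms(1) that(1) by simp
      then show False using \<open>\<not> f i \<le> t\<close> that(2) by simp
    qed
    then have "{k. k < n \<and> f k \<le> t} \<subseteq> {..<i}" by auto
    then have "card {k. k < n \<and> f k \<le> t} \<le> card {..<i}" by (intro card_mono) auto
    then show False using less by simp
  qed
qed

text \<open>
  The arguments of the ordered nodes are order statistics: the \<open>i\<close>-th one is at most \<open>t\<close> iff more
  than \<open>i\<close> of the arguments are, and that count is a sum of measurable indicators.
\<close>
lemma measurable_Arg2pi_ccw_nodes: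
  assumes X: "\<And>k. k < n \<Longrightarrow> X k \<in> borel_measurable M" and "i < n"
  shows "(\<lambda>\<omega>. Arg2pi (ccw_nodes n (\<lambda>k. X k \<omega>) i)) \<in> borel_measurable M"
  unfolding borel_measurable_iff_le
proof
  fix t :: real
  have meas [measurable]: "(\<lambda>\<omega>. X k \<omega> / X 0 \<omega>) \<in> borel_measurable M" if "k < n" for k
    using X[OF that] X[of 0] that by (intro borel_measurable_divide) auto
  have "Arg2pi (ccw_nodes n (\<lambda>k. X k \<omega>) i) \<le> t
      \<longleftrightarrow> real i < (\<Sum>k<n. indicator {..t} (Arg2pi (X k \<omega> / X 0 \<omega>)))" for \<omega>
  proof -
    have "Arg2pi (ccw_nodes n (\<lambda>k. X k \<omega>) i) \<le> t
        \<longleftrightarrow> i < card {k. k < n \<and> Arg2pi (ccw_nodes n (\<lambda>k. X k \<omega>) k) \<le> t}"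
      by (rule nth_sorted_le_iff_card[OF ccw_nodes_mono \<open>i < n\<close>])
    also have "card {k. k < n \<and> Arg2pi (ccw_nodes n (\<lambda>k. X k \<omega>) k) \<le> t}
        = card {k. k < n \<and> Arg2pi (X k \<omega> / X 0 \<omega>) \<le> t}"
      by (rule card_ccw_nodes)
    also have "i < card {k. k < n \<and> Arg2pi (X k \<omega> / X 0 \<omega>) \<le> t}
        \<longleftrightarrow> real i < (\<Sum>k<n. indicator {..t} (Arg2pi (X k \<omega> / X 0 \<omega>)))"
    proof -
      have "(\<Sum>k<n. indicat_real {..t} (Arg2pi (X k \<omega> / X 0 \<omega>)))
          = real (card {k. k < n \<and> Arg2pi (X k \<omega> / X 0 \<omega>) \<le> t})"
        using sum.inter_filter[of "{..<n}" "\<lambda>_. 1::real" "\<lambda>k. Arg2pi (X k \<omega> / X 0 \<omega>) \<le> t"]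
        by (simp add: indicator_def of_bool_def)
      then show ?thesis by (simp only: of_nat_less_iff)
    qed
    finally show ?thesis .
  qed
  moreover have "{\<omega> \<in> space M. real i < (\<Sum>k<n. indicator {..t} (Arg2pi (X k \<omega> / X 0 \<omega>)))} \<in> sets M"
    by measurable
  ultimately show "{\<omega> \<in> space M. Arg2pi (ccw_nodes n (\<lambda>k. X k \<omega>) i) \<le> t} \<in> sets M" by simp
qed

lemma stable_equilibrium_event_measurable:
  assumes sample: "uniform_circle_sample M n X" and "r \<le> pi"
  shows "{\<omega> \<in> space M. \<exists>u. asymptotically_stable_on n
      (kuramoto_field n r (rgg_adj r (ccw_nodes n (\<lambda>k. X k \<omega>)))) (zero_sum_hyperplane n) u
      \<and> has_index n u q} \<in> sets M"
proof (rule measurable_finite_relation_event[where n = n and Q = "\<lambda>A. \<exists>u. asymptotically_stable_on n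
      (kuramoto_field n r A) (zero_sum_hyperplane n) u \<and> has_index n u q"])
  interpret prob_space M using sample by (simp add: uniform_circle_sample_def)
  have X: "X k \<in> borel_measurable M" if "k < n" for k
    using sample that by (auto simp: uniform_circle_sample_def indep_vars_def)
  note [measurable] = measurable_Arg2pi_ccw_nodes[OF X]
  fix i j assume ij: "i < n" "j < n"
  have "rgg_adj r (ccw_nodes n (\<lambda>k. X k \<omega>)) i j \<longleftrightarrow> i \<noteq> j \<and>
      near r (Arg2pi (ccw_nodes n (\<lambda>k. X k \<omega>) i)) (Arg2pi (ccw_nodes n (\<lambda>k. X k \<omega>) j))"
    if "\<omega> \<in> space M" for \<omega>
  proof -
    have "X k \<omega> \<in> sphere 0 1" if "k < n" for k
      using sample \<open>\<omega> \<in> space M\<close> that by (simp add: uniform_circle_sample_def)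
    then show ?thesis by (intro rgg_adj_cis[OF \<open>r \<le> pi\<close>] ccw_nodes_sphere ij) auto
  qed
  then have "{\<omega> \<in> space M. rgg_adj r (ccw_nodes n (\<lambda>k. X k \<omega>)) i j}
      = {\<omega> \<in> space M. i \<noteq> j \<and> (\<exists>z::int.
          \<bar>Arg2pi (ccw_nodes n (\<lambda>k. X k \<omega>) i) - Arg2pi (ccw_nodes n (\<lambda>k. X k \<omega>) j) + 2 * pi * z\<bar> < r)}"
    by (auto simp: near_def)
  also have "\<dots> \<in> sets M" using ij by measurable
  finally show "{\<omega> \<in> space M. rgg_adj r (ccw_nodes n (\<lambda>k. X k \<omega>)) i j} \<in> sets M" .
next
  fix A B :: "nat \<Rightarrow> nat \<Rightarrow> bool"
  assume AB: "\<And>i j. i < n \<Longrightarrow> j < n \<Longrightarrow> A i j \<longleftrightarrow> B i j"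
  have "asymptotically_stable_on n (kuramoto_field n r A) (zero_sum_hyperplane n) u
      \<longleftrightarrow> asymptotically_stable_on n (kuramoto_field n r B) (zero_sum_hyperplane n) u" for u
  proof (rule asymptotically_stable_on_cong)
    fix u i assume "i < n"
    then have "{j. j < n \<and> A i j} = {j. j < n \<and> B i j}" using AB by auto
    then show "kuramoto_field n r A u i = kuramoto_field n r B u i" by (simp add: kuramoto_field_def)
  qed
  then show "(\<exists>u. asymptotically_stable_on n (kuramoto_field n r A) (zero_sum_hyperplane n) u \<and> has_index n u q)
    \<longleftrightarrow> (\<exists>u. asymptotically_stable_on n (kuramoto_field n r B) (zero_sum_hyperplane n) u \<and> has_index n u q)"
    by simp
qed

section \<open>Twisted equilibria exist with high probability\<close>

text \<open>
  A quantitative form of the result. With \<open>m\<close> about \<open>4 \<pi> / r\<close> sectors, \<open>large\<close> gives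
  \<open>n / (4 m) \<ge> 2 ln n\<close> and \<open>m \<le> n\<close>, so the union bound leaves an error of at most \<open>2 n \<cdot> n\<^sup>-\<^sup>2\<close>.
\<close>
lemma stable_equilibrium_probability_bound:
  fixes q :: int and r :: real
  assumes sample: "uniform_circle_sample M n X" and "n \<ge> 3" "0 < r"
    and small: "4032 * (real n * r\<^sup>2 * (q\<^sup>2 + 1)) \<le> 1"
    and large: "40 * pi * ln (real n) \<le> real n * r"
  shows "1 - 2 / real n \<le> \<P>(\<omega> in M. \<exists>u. asymptotically_stable_on n
      (kuramoto_field n r (rgg_adj r (ccw_nodes n (\<lambda>k. X k \<omega>)))) (zero_sum_hyperplane n) u
      \<and> has_index n u q)"
proof -
  interpret prob_space M using sample by (simp add: uniform_circle_sample_def)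
  define m where "m = nat \<lfloor>4 * pi / r\<rfloor> + 1"
  have "n > 0" using \<open>n \<ge> 3\<close> by simp
  have "r\<^sup>2 * 1 \<le> r\<^sup>2 * (real n * (q\<^sup>2 + 1))"
    using mult_mono[of 1 "real n" 1 "q\<^sup>2 + 1"] \<open>n \<ge> 3\<close> by (intro mult_left_mono) auto
  also have "\<dots> = real n * r\<^sup>2 * (q\<^sup>2 + 1)" by (simp add: mult.commute mult.left_commute)
  also have "\<dots> \<le> 1" using small by linarith
  finally have "r\<^sup>2 \<le> 1\<^sup>2" by simp
  then have "r \<le> 1" using \<open>0 < r\<close> unfolding abs_le_square_iff[symmetric] by simp
  then have "r \<le> pi" using pi_gt3 by linarith
  have m_eq: "real m = of_int \<lfloor>4 * pi / r\<rfloor> + 1" using \<open>0 < r\<close> by (simp add: m_def)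
  have m: "4 * pi < m * r" "m * r \<le> 5 * pi"
  proof -
    have "4 * pi / r < m" "m \<le> 4 * pi / r + 1" unfolding m_eq by linarith+
    then have "4 * pi < m * r" "m * r \<le> 4 * pi + r" using \<open>0 < r\<close> by (simp_all add: field_simps)
    then show "4 * pi < m * r" "m * r \<le> 5 * pi" using \<open>r \<le> pi\<close> by auto
  qed
  have "m > 0" by (simp add: m_def)
  have "1 \<le> ln (real n)"
    using exp_le \<open>n \<ge> 3\<close> by (subst ln_ge_iff) auto
  then have "40 * pi * 1 \<le> 40 * pi * ln (real n)" by (intro mult_left_mono) auto
  then have "m * r \<le> n * r" using m(2) large pi_gt_zero by linarith
  then have "m \<le> n" using \<open>0 < r\<close> by simp
  have "2 * ln (real n) \<le> n / (4 * real m)"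
  proof -
    have "8 * (m * r) * ln (real n) \<le> 8 * (5 * pi) * ln (real n)"
      using \<open>1 \<le> ln (real n)\<close> by (intro mult_right_mono mult_left_mono m) auto
    also have "\<dots> \<le> n * r" using large by simp
    finally have "(8 * m * ln (real n)) * r \<le> n * r" by (simp add: algebra_simps)
    then have "8 * m * ln (real n) \<le> n" using \<open>0 < r\<close> by simp
    then show ?thesis using \<open>m > 0\<close> by (simp add: field_simps)
  qed
  then have "exp (- (n / (4 * real m))) \<le> exp (- (2 * ln (real n)))" by simp
  also have "\<dots> = 1 / (real n)\<^sup>2"
    using \<open>n > 0\<close> by (simp add: exp_minus exp_double inverse_eq_divide)
  finally have "2 * real m * exp (- (n / (4 * real m))) \<le> 2 * n * (1 / (real n)\<^sup>2)"
    using \<open>m \<le> n\<close> by (intro mult_mono) auto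
  also have "\<dots> = 2 / n" using \<open>n > 0\<close> by (simp add: power2_eq_square)
  finally have "1 - 2 / n \<le> prob {\<omega> \<in> space M. equidistributed m n (\<lambda>k. X k \<omega>)}"
    using uniform_sample_equidistributed(2)[OF sample \<open>m > 0\<close>] by linarith
  also have "\<dots> \<le> prob {\<omega> \<in> space M. \<exists>u. asymptotically_stable_on n
      (kuramoto_field n r (rgg_adj r (ccw_nodes n (\<lambda>k. X k \<omega>)))) (zero_sum_hyperplane n) u
      \<and> has_index n u q}"
  proof (rule finite_measure_mono)
    show "{\<omega> \<in> space M. \<exists>u. asymptotically_stable_on n
      (kuramoto_field n r (rgg_adj r (ccw_nodes n (\<lambda>k. X k \<omega>)))) (zero_sum_hyperplane n) u
      \<and> has_index n u q} \<in> events"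
      by (rule stable_equilibrium_event_measurable[OF sample \<open>r \<le> pi\<close>])
    show "{\<omega> \<in> space M. equidistributed m n (\<lambda>k. X k \<omega>)} \<subseteq> {\<omega> \<in> space M. \<exists>u. asymptotically_stable_on n
      (kuramoto_field n r (rgg_adj r (ccw_nodes n (\<lambda>k. X k \<omega>)))) (zero_sum_hyperplane n) u
      \<and> has_index n u q}"
    proof (intro subsetI CollectI conjI)
      fix \<omega> assume \<omega>: "\<omega> \<in> {\<omega> \<in> space M. equidistributed m n (\<lambda>k. X k \<omega>)}"
      then show "\<omega> \<in> space M" by simp
      show "\<exists>u. asymptotically_stable_on n
        (kuramoto_field n r (rgg_adj r (ccw_nodes n (\<lambda>k. X k \<omega>)))) (zero_sum_hyperplane n) u
        \<and> has_index n u q"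
      proof (rule equidistributed_twisted_equilibrium[OF _ \<open>n > 0\<close> \<open>0 < r\<close> small m])
        show "X k \<omega> \<in> sphere 0 1" if "k < n" for k
          using sample \<omega> that by (simp add: uniform_circle_sample_def)
      qed (use \<omega> in simp)
    qed
  qed
  finally show ?thesis .
qed

theorem theorem1p1:
  fixes \<epsilon> :: "nat \<Rightarrow> real"
    and M :: "nat \<Rightarrow> 'a measure"
    and X :: "nat \<Rightarrow> nat \<Rightarrow> 'a \<Rightarrow> complex"
    and q :: int
  assumes "\<And>n. \<epsilon> n > 0"
    and "(\<lambda>n. real n * (\<epsilon> n)\<^sup>2) \<longlonglongrightarrow> 0"
    and "filterlim (\<lambda>n. real n * \<epsilon> n / ln (real n)) at_top sequentially"
    and "\<And>n. uniform_circle_sample (M n) n (X n)"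
  shows "(\<lambda>n. \<P>(\<omega> in M n. \<exists>u.
            asymptotically_stable_on n
              (kuramoto_field n (\<epsilon> n) (rgg_adj (\<epsilon> n) (ccw_nodes n (\<lambda>i. X n i \<omega>))))
              (zero_sum_hyperplane n) u
            \<and> has_index n u q)) \<longlonglongrightarrow> 1"
proof (rule tendsto_sandwich)
  have "(\<lambda>n. 4032 * (real n * (\<epsilon> n)\<^sup>2 * ((real_of_int q)\<^sup>2 + 1))) \<longlonglongrightarrow> 4032 * (0 * ((real_of_int q)\<^sup>2 + 1))"
    by (intro tendsto_intros assms(2))
  then have small: "\<forall>\<^sub>F n in sequentially. 4032 * (real n * (\<epsilon> n)\<^sup>2 * ((real_of_int q)\<^sup>2 + 1)) < 1"
    by (rule order_tendstoD) simp
  have large: "\<forall>\<^sub>F n in sequentially. 40 * pi \<le> real n * \<epsilon> n / ln (real n)"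
    using assms(3) by (simp add: filterlim_at_top)
  show "\<forall>\<^sub>F n in sequentially. 1 - 2 / real n \<le> \<P>(\<omega> in M n. \<exists>u.
            asymptotically_stable_on n
              (kuramoto_field n (\<epsilon> n) (rgg_adj (\<epsilon> n) (ccw_nodes n (\<lambda>i. X n i \<omega>))))
              (zero_sum_hyperplane n) u
            \<and> has_index n u q)"
    using small large eventually_ge_at_top[of 3]
  proof eventually_elim
    case (elim n)
    then have "ln (real n) > 0" by simp
    with elim show ?case
      by (intro stable_equilibrium_probability_bound assms(1) assms(4)) (auto simp: field_simps)
  qed
  show "\<forall>\<^sub>F n in sequentially. \<P>(\<omega> in M n. \<exists>u.
            asymptotically_stable_on n
              (kuramoto_field n (\<epsilon> n) (rgg_adj (\<epsilon> n) (ccw_nodes n (\<lambda>i. X n i \<omega>))))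
              (zero_sum_hyperplane n) u
            \<and> has_index n u q) \<le> 1"
    using assms(4) by (auto simp: uniform_circle_sample_def intro!: always_eventually prob_space.prob_le_1)
  have "(\<lambda>n. 1 - 2 / real n) \<longlonglongrightarrow> 1 - 0"
    by (intro tendsto_intros lim_const_over_n)
  then show "(\<lambda>n. 1 - 2 / real n) \<longlonglongrightarrow> 1" by simp
qed simp

end
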